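(* Let $u_h$, with $u_h(\cdot,t)\in V_h$, solve the unforced damped second-order semidiscrete problem: for all $t\ge0$ and $v_h\in V_h$, $$\left(\tfrac1Hu_{h,tt},v_h\right)+\tfrac1\epsilon\left(\tfrac fHu_{h,t}^\perp,v_h\right)+\tfrac{\beta}{\epsilon^2}\left(\nabla\cdot u_h,\nabla\cdot v_h\right)+\left(\tfrac CHu_{h,t},v_h\right)=0,$$ and let $E(t)=\tfrac12\|u_{h,t}\|_{1/H}^2+\tfrac{\beta}{2\epsilon^2}\|\nabla\cdot u_h\|^2$. Define $$\alpha_1=\frac{\sqrt{\beta H_*}}{2C_P\epsilon},\qquad \alpha_2=\frac{2C_*}{1+\chi},\qquad \chi=2+\frac{C_P^2(1+\epsilon C^* )^2}{\beta H_*}.$$ Then for any $0<\alpha\le\min\{\alpha_1,\alpha_2\}$ and any $t>0$, $$E(t)\le 3E(0)\,e^{-\frac{2\alpha}{3}t}.$$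
   Context: $\Omega\subset\mathbb R^2$ is a bounded domain. $(\cdot,\cdot)$ and $\|\cdot\|$ are the $L^2(\Omega)$ inner product and norm. For a positive weight $\kappa$, $\|g\|_\kappa^2=\int_\Omega\kappa|g|^2\,dx$. For a vector field $u=(u_1,u_2)$, $u^\perp=(-u_2,u_1)$. Subscript $t$ denotes time derivative. $\epsilon,\beta>0$ are constants. $H$ is a function with $0<H_*\le H\le H^*<\infty$ a.e. $f$ is a function with $|f|\le1$. The damping coefficient $C$ is a function with $0<C_*\le C\le C^*<\infty$. $V=H(\mathrm{div};\Omega)$, with $u\cdot n=0$ on any boundary. $V_h\subset V$ is a finite-dimensional Raviart–Thomas, Brezzi–Douglas–Marini or Brezzi–Douglas–Fortin–Marini space on triangles. Helmholtz decomposition: every $u\in V_h$ is written uniquely as $u=u^D+u^S$ with $u^D,u^S\in V_h$, where $\nabla\cdot u^S=0$ and $u^D$ is orthogonal, in the inner product $(\frac1H\cdot,\cdot)$, to all divergence-free elements of $V_h$. $C_P>0$ is a constant for the generalized Poincaré–Friedrichs inequality $\|u^D\|_{1/H}\le C_P\|\nabla\cdot u^D\|_{1/H}$ for all such $u^D$ (in $V_h$, as well as for the analogous decomposition of $V$). *)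

theory Defs
  imports "HOL-Analysis.Analysis" "HOL-Computational_Algebra.Polynomial"
begin

type_synonym scalar_field = "real^2 \<Rightarrow> real"
type_synonym vector_field = "real^2 \<Rightarrow> real^2"

definition perp :: "real^2 \<Rightarrow> real^2" where
  "perp v = vector [- v $ 2, v $ 1]"

definition bounded_domain :: "(real^2) set \<Rightarrow> bool" where
  "bounded_domain \<Omega> \<longleftrightarrow> open \<Omega> \<and> connected \<Omega> \<and> bounded \<Omega> \<and> \<Omega> \<noteq> {}"


subsection \<open>Square integrable functions\<close>

text \<open>Elements of L2 are represented by functions on the whole plane, of which only the values
  almost everywhere in the domain matter.\<close>

definition L2 :: "(real^2) set \<Rightarrow> (real^2 \<Rightarrow> 'b::euclidean_space) set" where
  "L2 \<Omega> = {g. g \<in> borel_measurable (lebesgue_on \<Omega>) \<and>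
               integrable (lebesgue_on \<Omega>) (\<lambda>x. (norm (g x))\<^sup>2)}"

definition l2_inner ::
    "(real^2) set \<Rightarrow> (real^2 \<Rightarrow> 'b::euclidean_space) \<Rightarrow> (real^2 \<Rightarrow> 'b) \<Rightarrow> real" where
  "l2_inner \<Omega> u v = integral\<^sup>L (lebesgue_on \<Omega>) (\<lambda>x. u x \<bullet> v x)"

definition l2_norm :: "(real^2) set \<Rightarrow> (real^2 \<Rightarrow> 'b::euclidean_space) \<Rightarrow> real" where
  "l2_norm \<Omega> g = sqrt (l2_inner \<Omega> g g)"

definition weighted_norm ::
    "(real^2) set \<Rightarrow> scalar_field \<Rightarrow> (real^2 \<Rightarrow> 'b::euclidean_space) \<Rightarrow> real" where
  "weighted_norm \<Omega> \<kappa> g = sqrt (integral\<^sup>L (lebesgue_on \<Omega>) (\<lambda>x. \<kappa> x * (norm (g x))\<^sup>2))"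


subsection \<open>Weak derivatives and the space H(div)\<close>

definition partial :: "scalar_field \<Rightarrow> 2 \<Rightarrow> scalar_field" where
  "partial \<phi> i x = frechet_derivative \<phi> (at x) (axis i 1)"

definition grad :: "scalar_field \<Rightarrow> vector_field" where
  "grad \<phi> x = (\<chi> i. partial \<phi> i x)"

primrec C_k :: "nat \<Rightarrow> scalar_field \<Rightarrow> bool" where
  "C_k 0 \<phi> \<longleftrightarrow> continuous_on UNIV \<phi>"
| "C_k (Suc k) \<phi> \<longleftrightarrow> (\<forall>x. \<phi> differentiable (at x)) \<and> (\<forall>i. C_k k (partial \<phi> i))"

definition test_functions :: "(real^2) set \<Rightarrow> scalar_field set" where
  "test_functions \<Omega> =
     {\<phi>. (\<forall>k. C_k k \<phi>) \<and> compact (closure {x. \<phi> x \<noteq> 0}) \<and> closure {x. \<phi> x \<noteq> 0} \<subseteq> \<Omega>}"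

definition is_weak_div :: "(real^2) set \<Rightarrow> vector_field \<Rightarrow> scalar_field \<Rightarrow> bool" where
  "is_weak_div \<Omega> u g \<longleftrightarrow> u \<in> L2 \<Omega> \<and> g \<in> L2 \<Omega> \<and>
     (\<forall>\<phi>\<in>test_functions \<Omega>. l2_inner \<Omega> u (grad \<phi>) = - l2_inner \<Omega> g \<phi>)"

definition is_weak_grad :: "(real^2) set \<Rightarrow> scalar_field \<Rightarrow> vector_field \<Rightarrow> bool" where
  "is_weak_grad \<Omega> \<phi> G \<longleftrightarrow> \<phi> \<in> L2 \<Omega> \<and> G \<in> L2 \<Omega> \<and>
     (\<forall>\<psi>\<in>test_functions \<Omega>. \<forall>i. l2_inner \<Omega> \<phi> (partial \<psi> i) = - l2_inner \<Omega> (\<lambda>x. G x $ i) \<psi>)"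

text \<open>The weak divergence is determined only up to null sets; \<open>wdiv\<close> picks a representative.
  It is meaningful for fields that have a square integrable weak divergence.\<close>

definition wdiv :: "(real^2) set \<Rightarrow> vector_field \<Rightarrow> scalar_field" where
  "wdiv \<Omega> u = (SOME g. is_weak_div \<Omega> u g)"

definition Hdiv :: "(real^2) set \<Rightarrow> vector_field set" where
  "Hdiv \<Omega> = {u. \<exists>g. is_weak_div \<Omega> u g}"

definition Hdiv_norm :: "(real^2) set \<Rightarrow> vector_field \<Rightarrow> real" where
  "Hdiv_norm \<Omega> u = sqrt ((l2_norm \<Omega> u)\<^sup>2 + (l2_norm \<Omega> (wdiv \<Omega> u))\<^sup>2)"

text \<open>The normal trace of a field \<open>u\<close> in H(div) is the functional
  \<open>\<phi> \<mapsto> (u, grad \<phi>) + (div u, \<phi>)\<close> on H1, and \<open>u \<cdot> n = 0\<close> says that it vanishes.\<close>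

definition zero_normal_trace :: "(real^2) set \<Rightarrow> vector_field \<Rightarrow> bool" where
  "zero_normal_trace \<Omega> u \<longleftrightarrow>
     (\<forall>\<phi> G. is_weak_grad \<Omega> \<phi> G \<longrightarrow> l2_inner \<Omega> u G + l2_inner \<Omega> (wdiv \<Omega> u) \<phi> = 0)"

definition Hdiv0 :: "(real^2) set \<Rightarrow> vector_field set" where
  "Hdiv0 \<Omega> = {u \<in> Hdiv \<Omega>. zero_normal_trace \<Omega> u}"


subsection \<open>Mixed finite element spaces on triangles\<close>

definition mesh :: "(real^2) set \<Rightarrow> (real^2) set set \<Rightarrow> bool" where
  "mesh \<Omega> \<T> \<longleftrightarrow> triangulation \<T> \<and> (\<forall>K\<in>\<T>. 2 simplex K) \<and> \<Union>\<T> = closure \<Omega>"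

definition polys :: "nat \<Rightarrow> scalar_field set" where
  "polys k = {p. \<exists>c :: nat \<Rightarrow> nat \<Rightarrow> real. \<forall>x.
     p x = (\<Sum>i\<le>k. \<Sum>j\<le>k - i. c i j * (x $ 1) ^ i * (x $ 2) ^ j)}"

definition vpolys :: "nat \<Rightarrow> vector_field set" where
  "vpolys k = {p. \<forall>i. (\<lambda>x. p x $ i) \<in> polys k}"

definition RT_local :: "nat \<Rightarrow> vector_field set" where
  "RT_local k = {\<lambda>x. p x + q x *\<^sub>R x | p q. p \<in> vpolys k \<and> q \<in> polys k}"

definition BDM_local :: "nat \<Rightarrow> vector_field set" where
  "BDM_local k = vpolys k"

text \<open>Vector polynomials of degree at most \<open>k\<close> whose normal component on every edge of the triangle
  has degree at most \<open>k - 1\<close>; \<open>perp (b - a)\<close> is a (scaled) normal to the edge from \<open>a\<close> to \<open>b\<close>.\<close>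

definition BDFM_local :: "nat \<Rightarrow> (real^2) set \<Rightarrow> vector_field set" where
  "BDFM_local k K = {p \<in> vpolys k. \<forall>a b. a extreme_point_of K \<and> b extreme_point_of K \<and> a \<noteq> b \<longrightarrow>
     (\<exists>q :: real poly. degree q \<le> k - 1 \<and>
        (\<forall>s\<in>{0..1}. p ((1 - s) *\<^sub>R a + s *\<^sub>R b) \<bullet> perp (b - a) = poly q s))}"

definition fe_space ::
    "(real^2) set \<Rightarrow> (real^2) set set \<Rightarrow> ((real^2) set \<Rightarrow> vector_field set) \<Rightarrow> vector_field set" where
  "fe_space \<Omega> \<T> P =
     {v \<in> Hdiv0 \<Omega>. \<forall>K\<in>\<T>. \<exists>p\<in>P K. AE x in lebesgue_on \<Omega>. x \<in> K \<longrightarrow> v x = p x}"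

text \<open>Indices start at 0 for Raviart-Thomas and at 1 for the other two families; the lowest order
  members of the Raviart-Thomas and Brezzi-Douglas-Fortin-Marini families coincide.\<close>

definition mixed_fe_space :: "(real^2) set \<Rightarrow> vector_field set \<Rightarrow> bool" where
  "mixed_fe_space \<Omega> Vh \<longleftrightarrow> (\<exists>\<T> k. mesh \<Omega> \<T> \<and>
     (Vh = fe_space \<Omega> \<T> (\<lambda>K. RT_local k) \<or>
      (k \<ge> 1 \<and> Vh = fe_space \<Omega> \<T> (\<lambda>K. BDM_local k)) \<or>
      (k \<ge> 1 \<and> Vh = fe_space \<Omega> \<T> (\<lambda>K. BDFM_local k K))))"


subsection \<open>Helmholtz decomposition and the Poincare-Friedrichs constant\<close>

definition div_free :: "(real^2) set \<Rightarrow> vector_field \<Rightarrow> bool" where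
  "div_free \<Omega> u \<longleftrightarrow> (AE x in lebesgue_on \<Omega>. wdiv \<Omega> u x = 0)"

definition helmholtz_decomp ::
    "(real^2) set \<Rightarrow> scalar_field \<Rightarrow> vector_field set \<Rightarrow>
     vector_field \<Rightarrow> vector_field \<Rightarrow> vector_field \<Rightarrow> bool" where
  "helmholtz_decomp \<Omega> H W u uD uS \<longleftrightarrow> u \<in> W \<and> uD \<in> W \<and> uS \<in> W \<and>
     (AE x in lebesgue_on \<Omega>. u x = uD x + uS x) \<and> div_free \<Omega> uS \<and>
     (\<forall>w\<in>W. div_free \<Omega> w \<longrightarrow> l2_inner \<Omega> (\<lambda>x. (1 / H x) *\<^sub>R uD x) w = 0)"

definition friedrichs_constant ::
    "(real^2) set \<Rightarrow> scalar_field \<Rightarrow> vector_field set \<Rightarrow> real \<Rightarrow> bool" where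
  "friedrichs_constant \<Omega> H W CP \<longleftrightarrow> (\<forall>u uD uS. helmholtz_decomp \<Omega> H W u uD uS \<longrightarrow>
     weighted_norm \<Omega> (\<lambda>x. 1 / H x) uD \<le> CP * weighted_norm \<Omega> (\<lambda>x. 1 / H x) (wdiv \<Omega> uD))"


subsection \<open>The semidiscrete problem\<close>

text \<open>\<open>u'\<close> is the derivative of the curve \<open>u\<close> in \<open>W\<close>, with respect to the norm of H(div)
  (on the finite dimensional spaces considered here all norms are equivalent); the derivative at
  time 0 is one-sided.\<close>

definition time_derivative ::
    "(real^2) set \<Rightarrow> vector_field set \<Rightarrow> (real \<Rightarrow> vector_field) \<Rightarrow> (real \<Rightarrow> vector_field) \<Rightarrow> bool" where
  "time_derivative \<Omega> W u u' \<longleftrightarrow> (\<forall>t\<ge>0. u t \<in> W \<and> u' t \<in> W \<and>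
     ((\<lambda>s. Hdiv_norm \<Omega> (\<lambda>x. (u s x - u t x) /\<^sub>R (s - t) - u' t x)) \<longlongrightarrow> 0) (at t within {0..}))"

definition damped_semidiscrete_solution ::
    "(real^2) set \<Rightarrow> vector_field set \<Rightarrow> scalar_field \<Rightarrow> scalar_field \<Rightarrow> scalar_field \<Rightarrow>
     real \<Rightarrow> real \<Rightarrow> (real \<Rightarrow> vector_field) \<Rightarrow> (real \<Rightarrow> vector_field) \<Rightarrow> (real \<Rightarrow> vector_field) \<Rightarrow> bool"
where
  "damped_semidiscrete_solution \<Omega> Vh H f C \<epsilon> \<beta> u ut utt \<longleftrightarrow>
     time_derivative \<Omega> Vh u ut \<and> time_derivative \<Omega> Vh ut utt \<and>
     (\<forall>t\<ge>0. \<forall>v\<in>Vh.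
        l2_inner \<Omega> (\<lambda>x. (1 / H x) *\<^sub>R utt t x) v
        + 1 / \<epsilon> * l2_inner \<Omega> (\<lambda>x. (f x / H x) *\<^sub>R perp (ut t x)) v
        + \<beta> / \<epsilon>\<^sup>2 * l2_inner \<Omega> (wdiv \<Omega> (u t)) (wdiv \<Omega> v)
        + l2_inner \<Omega> (\<lambda>x. (C x / H x) *\<^sub>R ut t x) v = 0)"

definition energy ::
    "(real^2) set \<Rightarrow> scalar_field \<Rightarrow> real \<Rightarrow> real \<Rightarrow>
     (real \<Rightarrow> vector_field) \<Rightarrow> (real \<Rightarrow> vector_field) \<Rightarrow> real \<Rightarrow> real" where
  "energy \<Omega> H \<epsilon> \<beta> u ut t =
     1 / 2 * (weighted_norm \<Omega> (\<lambda>x. 1 / H x) (ut t))\<^sup>2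
     + \<beta> / (2 * \<epsilon>\<^sup>2) * (l2_norm \<Omega> (wdiv \<Omega> (u t)))\<^sup>2"

end

theory Submission
  imports Defs
begin

text \<open>
  Testing the equation with \<open>u\<^sub>t\<close> gives \<open>E' = - (C/H u\<^sub>t, u\<^sub>t)\<close>: the rotation term vanishes because
  \<open>v\<^sup>\<bottom> \<bullet> v = 0\<close>. This controls only the kinetic half of the energy. To see decay of the
  potential half as well, the energy is perturbed by \<open>G = (1/H u\<^sub>t, u\<^sup>D)\<close>. Testing with \<open>u\<^sup>D\<close>,
  whose divergence is that of \<open>u\<close>, makes \<open>G'\<close> contribute
  \<open>- \<beta>/\<epsilon>\<^sup>2 \<parallel>div u\<parallel>\<^sup>2\<close>; what remains is \<open>\<parallel>(u\<^sub>t)\<^sup>D\<parallel>\<^sup>2 \<le> \<parallel>u\<^sub>t\<parallel>\<^sup>2\<close> and cross terms,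
  which the Poincare-Friedrichs inequality for \<open>u\<^sup>D\<close> and Young's inequality absorb. Write \<open>a\<close> for the
  weighted norm of \<open>u\<^sub>t\<close> and \<open>d\<^sup>2 = \<beta>/\<epsilon>\<^sup>2 \<parallel>div u\<parallel>\<^sup>2\<close>, so \<open>E = (a\<^sup>2 + d\<^sup>2)/2\<close>. Then
  \<open>G' \<le> chi/2 a\<^sup>2 - d\<^sup>2/2\<close>. The bound \<open>\<alpha> \<le> \<alpha>\<^sub>1\<close> is what makes \<open>\<bar>\<alpha> G\<bar> \<le> E/2\<close>, and
  \<open>\<alpha> \<le> \<alpha>\<^sub>2\<close> is what makes \<open>(E + \<alpha> G)' \<le> - \<alpha> E \<le> - 2\<alpha>/3 (E + \<alpha> G)\<close>. Integrating, and comparing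
  \<open>E\<close> with \<open>E + \<alpha> G\<close> at both ends, costs a factor \<open>2 \<cdot> 3/2 = 3\<close>. This argument is about two
  semi-inner products, a projection and a bounded coercive form for rotation and damping; it is
  \<open>damped_wave_energy_decay\<close>.

  Applying it needs three facts about the concrete spaces. First, all constructions go through
  \<open>wdiv\<close>, which selects some weak divergence, so linearity of \<open>wdiv\<close> up to null sets rests on
  uniqueness of weak divergences (\<open>weak_div_unique\<close>), that is, on the fundamental lemma of the
  calculus of variations (\<open>AE_zero_if_orthogonal_to_test_functions\<close>); smooth compactly supported
  functions are built from \<open>exp (-1/s)\<close>. Second, \<open>u\<^sup>D\<close> must exist in \<open>Vh\<close>: elements of
  \<open>Vh\<close> are determined almost everywhere by finitely many polynomial coefficients
  (\<open>mixed_fe_space_coefficients\<close>), and orthogonal projections onto such spaces exist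
  (\<open>ex_orthogonal_projection\<close>). Third, derivatives of curves are limits of difference quotients in
  the H(div) norm, which dominates both seminorms, and the projection is a contraction, so the product
  rule applies to \<open>E\<close> and \<open>G\<close>.
\<close>

section \<open>One-dimensional smooth functions\<close>

text \<open>Being \<open>k\<close> times differentiable, in a form that suits induction: the derivative is a witness rather
  than \<open>deriv f\<close>, so sums and products are handled by exhibiting it.\<close>

primrec diff_times :: "nat \<Rightarrow> (real \<Rightarrow> real) \<Rightarrow> bool" where
  "diff_times 0 f \<longleftrightarrow> True"
| "diff_times (Suc k) f \<longleftrightarrow>
     (\<exists>f'. (\<forall>x. (f has_real_derivative f' x) (at x)) \<and> diff_times k f')"

definition smooth :: "(real \<Rightarrow> real) \<Rightarrow> bool" where
  "smooth f \<longleftrightarrow> (\<forall>k. diff_times k f)"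

lemma diff_times_SucI:
  "(\<And>x. (f has_real_derivative f' x) (at x)) \<Longrightarrow> diff_times k f' \<Longrightarrow> diff_times (Suc k) f"
  by auto

lemma diff_times_Suc_D: "diff_times (Suc k) f \<Longrightarrow> diff_times k f"
proof (induction k arbitrary: f)
  case (Suc k)
  then obtain f' where "\<And>x. (f has_real_derivative f' x) (at x)" "diff_times (Suc k) f'"
    by (auto simp only: diff_times.simps(2)[of "Suc k" f])
  with Suc.IH show ?case by (intro diff_times_SucI)
qed simp

lemma diff_times_add: "diff_times k f \<Longrightarrow> diff_times k g \<Longrightarrow> diff_times k (\<lambda>x. f x + g x)"
proof (induction k arbitrary: f g)
  case (Suc k)
  from Suc.prems obtain f' g' where
    f: "\<And>x. (f has_real_derivative f' x) (at x)" "diff_times k f'" and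
    g: "\<And>x. (g has_real_derivative g' x) (at x)" "diff_times k g'"
    by auto
  have "((\<lambda>x. f x + g x) has_real_derivative (f' x + g' x)) (at x)" for x
    by (rule DERIV_add[OF f(1) g(1)])
  then show ?case using Suc.IH[OF f(2) g(2)] by (rule diff_times_SucI)
qed simp

lemma diff_times_mult: "diff_times k f \<Longrightarrow> diff_times k g \<Longrightarrow> diff_times k (\<lambda>x. f x * g x)"
proof (induction k arbitrary: f g)
  case (Suc k)
  from Suc.prems obtain f' g' where
    f: "\<And>x. (f has_real_derivative f' x) (at x)" "diff_times k f'" and
    g: "\<And>x. (g has_real_derivative g' x) (at x)" "diff_times k g'"
    by auto
  have "((\<lambda>x. f x * g x) has_real_derivative (f' x * g x + g' x * f x)) (at x)" for x
    by (rule DERIV_mult[OF f(1) g(1)])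
  moreover have "diff_times k (\<lambda>x. f' x * g x + g' x * f x)"
    using Suc.IH[OF f(2) diff_times_Suc_D[OF Suc.prems(2)]]
      Suc.IH[OF g(2) diff_times_Suc_D[OF Suc.prems(1)]] by (rule diff_times_add)
  ultimately show ?case by (rule diff_times_SucI)
qed simp

lemma diff_times_const: "diff_times k (\<lambda>x. c)"
  by (induction k arbitrary: c) (simp, rule diff_times_SucI[OF DERIV_const])

lemma diff_times_affine: "diff_times k f \<Longrightarrow> diff_times k (\<lambda>x. f (a * x + b))"
proof (induction k arbitrary: f)
  case (Suc k)
  from Suc.prems obtain f' where
    f: "\<And>x. (f has_real_derivative f' x) (at x)" "diff_times k f'"
    by auto
  have "((\<lambda>x. f (a * x + b)) has_real_derivative (f' (a * x + b) * a)) (at x)" for x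
  proof (rule DERIV_chain2[where f = f and g = "\<lambda>x. a * x + b", OF f(1)])
    show "((\<lambda>x. a * x + b) has_real_derivative a) (at x)"
      by (auto intro!: derivative_eq_intros)
  qed
  moreover have "diff_times k (\<lambda>x. f' (a * x + b) * a)"
    by (rule diff_times_mult[OF Suc.IH[OF f(2)] diff_times_const])
  ultimately show ?case by (rule diff_times_SucI)
qed simp

lemma smooth_deriv:
  assumes "smooth f"
  shows "(f has_real_derivative deriv f x) (at x)" and "smooth (deriv f)"
proof -
  have *: "(\<forall>x. (f has_real_derivative deriv f x) (at x)) \<and> diff_times k (deriv f)" for k
  proof -
    have "diff_times (Suc k) f" using assms unfolding smooth_def by blast
    then obtain f' where f': "\<And>x. (f has_real_derivative f' x) (at x)" "diff_times k f'"
      by auto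
    have "deriv f = f'" using f'(1) DERIV_imp_deriv by blast
    with f' show ?thesis by simp
  qed
  show "(f has_real_derivative deriv f x) (at x)" using * by blast
  show "smooth (deriv f)" using * unfolding smooth_def by blast
qed

text \<open>The classical smooth function that is flat at 0 is \<open>flat_exp 1\<close>. The polynomial factor makes the
  family closed under differentiation: on \<open>s > 0\<close> the derivative of \<open>p(1/s) exp(-1/s)\<close> is
  \<open>(1/s)\<^sup>2 (p - p')(1/s) exp(-1/s)\<close>.\<close>

definition flat_exp :: "real poly \<Rightarrow> real \<Rightarrow> real" where
  "flat_exp p s = (if s > 0 then poly p (1 / s) * exp (- (1 / s)) else 0)"

lemma poly_div_exp_tendsto_0: "((\<lambda>x. poly p x / exp x) \<longlongrightarrow> (0::real)) at_top"
proof -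
  have "((\<lambda>x. \<Sum>i\<le>degree p. coeff p i * (x ^ i / exp x)) \<longlongrightarrow> (\<Sum>i\<le>degree p. coeff p i * 0)) at_top"
    by (intro tendsto_intros tendsto_power_div_exp_0)
  then show ?thesis by (simp add: poly_altdef sum_divide_distrib)
qed

lemma flat_exp_tendsto_0: "(flat_exp p \<longlongrightarrow> 0) (at_right 0)"
proof -
  have "((\<lambda>s. poly p (inverse s) / exp (inverse s)) \<longlongrightarrow> 0) (at_right (0::real))"
    by (rule filterlim_compose[OF poly_div_exp_tendsto_0 filterlim_inverse_at_top_right])
  then show ?thesis
    by (rule tendsto_cong[THEN iffD1, rotated])
      (auto simp: eventually_at_filter flat_exp_def exp_minus field_simps)
qed

text \<open>Only \<open>s = 0\<close> needs an argument: the difference quotient there is again of the form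
  \<open>p(1/s) exp(-1/s)\<close>, which tends to 0.\<close>

lemma flat_exp_has_derivative:
  "(flat_exp p has_real_derivative flat_exp (monom 1 2 * (p - pderiv p)) s) (at s)"
proof -
  consider "s < 0" | "s = 0" | "s > 0" by linarith
  then show ?thesis
  proof cases
    case 1
    have "((\<lambda>_. 0) has_real_derivative 0) (at s)" by simp
    then have "(flat_exp p has_real_derivative 0) (at s)"
      by (rule DERIV_cong_ev[THEN iffD1, rotated -1])
        (use 1 in \<open>auto simp: flat_exp_def intro!: eventually_mono[OF eventually_nhds_in_open[of "{..<0}" s]]\<close>)
    with 1 show ?thesis by (simp add: flat_exp_def)
  next
    case 2
    have "((\<lambda>y. (flat_exp p y - flat_exp p 0) / (y - 0)) \<longlongrightarrow> 0) (at_left 0)"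
      by (rule tendsto_eventually) (auto simp: eventually_at_filter flat_exp_def)
    moreover have "((\<lambda>y. (flat_exp p y - flat_exp p 0) / (y - 0)) \<longlongrightarrow> 0) (at_right 0)"
      using flat_exp_tendsto_0[of "monom 1 1 * p"]
      by (rule tendsto_cong[THEN iffD1, rotated])
        (auto simp: eventually_at_filter flat_exp_def poly_monom)
    ultimately have "((\<lambda>y. (flat_exp p y - flat_exp p 0) / (y - 0)) \<longlongrightarrow> 0) (at 0)"
      using filterlim_split_at by blast
    with 2 show ?thesis by (simp add: has_field_derivative_iff flat_exp_def)
  next
    case 3
    have inv: "((\<lambda>s. 1 / s) has_real_derivative - (1 / s\<^sup>2)) (at s)"
      using 3 by (auto intro!: derivative_eq_intros simp: power2_eq_square)
    have "((\<lambda>s. poly p (1 / s) * exp (- (1 / s))) has_real_derivative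
        (poly (pderiv p) (1 / s) * - (1 / s\<^sup>2)) * exp (- (1 / s))
        + (exp (- (1 / s)) * - (- (1 / s\<^sup>2))) * poly p (1 / s)) (at s)"
      by (intro DERIV_mult DERIV_minus inv DERIV_chain2[where f = exp, OF DERIV_exp]
          DERIV_chain2[where f = "poly p", OF poly_DERIV])
    moreover have "(poly (pderiv p) (1 / s) * - (1 / s\<^sup>2)) * exp (- (1 / s))
        + (exp (- (1 / s)) * - (- (1 / s\<^sup>2))) * poly p (1 / s) = flat_exp (monom 1 2 * (p - pderiv p)) s"
      using 3 by (simp add: flat_exp_def poly_monom power2_eq_square algebra_simps)
    ultimately have "((\<lambda>s. poly p (1 / s) * exp (- (1 / s))) has_real_derivative
        flat_exp (monom 1 2 * (p - pderiv p)) s) (at s)" by simp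
    then show ?thesis
      by (rule DERIV_cong_ev[THEN iffD1, rotated -1])
        (use 3 in \<open>auto simp: flat_exp_def intro!: eventually_mono[OF eventually_nhds_in_open[of "{0<..}" s]]\<close>)
  qed
qed

lemma smooth_flat_exp: "smooth (flat_exp p)"
proof -
  have "diff_times k (flat_exp p)" for k
    by (induction k arbitrary: p) (simp, rule diff_times_SucI[OF flat_exp_has_derivative])
  then show ?thesis by (simp add: smooth_def)
qed

text \<open>A partial derivative of \<open>f(x\<^sub>1) g(x\<^sub>2)\<close> has the same shape, with \<open>f\<close> or \<open>g\<close>
  differentiated, so one-dimensional smoothness is enough for test functions in the plane.\<close>

lemma C_k_product:
  "smooth f \<Longrightarrow> smooth g \<Longrightarrow> C_k k (\<lambda>x. f (x $ 1) * g (x $ 2))"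
proof (induction k arbitrary: f g)
  case 0
  have "continuous_on UNIV h" if "smooth h" for h
    using smooth_deriv(1)[OF that] DERIV_isCont continuous_at_imp_continuous_on by blast
  with 0 have "continuous_on UNIV f" "continuous_on UNIV g" by auto
  then have "continuous_on UNIV (\<lambda>x::real^2. f (x $ 1))" "continuous_on UNIV (\<lambda>x::real^2. g (x $ 2))"
    by (auto intro!: continuous_on_compose2[of UNIV _ UNIV "\<lambda>x. x $ i" for i] continuous_on_component)
  then show ?case by (simp add: continuous_on_mult)
next
  case (Suc k)
  let ?\<phi> = "\<lambda>x::real^2. f (x $ 1) * g (x $ 2)"
  have comp: "((\<lambda>x. h (x $ i)) has_derivative (\<lambda>v. deriv h (x $ i) * v $ i)) (at x)"
    if "smooth h" for h i and x :: "real^2"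
    by (rule has_derivative_compose[of "\<lambda>x. x $ i", OF _
          smooth_deriv(1)[OF that, unfolded has_field_derivative_def]])
      (rule bounded_linear_imp_has_derivative[OF bounded_linear_vec_nth])
  have D: "(?\<phi> has_derivative
      (\<lambda>v. f (x $ 1) * (deriv g (x $ 2) * v $ 2) + deriv f (x $ 1) * v $ 1 * g (x $ 2))) (at x)" for x
    by (rule has_derivative_mult[OF comp[OF Suc.prems(1)] comp[OF Suc.prems(2)]])
  have "?\<phi> differentiable (at x)" for x
    using D differentiable_def by blast
  moreover have "C_k k (partial ?\<phi> i)" for i
  proof -
    have "partial ?\<phi> i = (\<lambda>x. f (x $ 1) * (deriv g (x $ 2) * axis i 1 $ 2)
        + deriv f (x $ 1) * axis i 1 $ 1 * g (x $ 2))"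
      unfolding partial_def by (rule ext) (simp add: frechet_derivative_at[OF D, symmetric])
    also have "\<dots> = (if i = 1 then (\<lambda>x. deriv f (x $ 1) * g (x $ 2)) else (\<lambda>x. f (x $ 1) * deriv g (x $ 2)))"
      using exhaust_2[of i] by (auto simp: axis_def)
    finally show ?thesis
      using Suc.IH smooth_deriv(2) Suc.prems by simp
  qed
  ultimately show ?case by simp
qed

section \<open>The fundamental lemma of the calculus of variations\<close>

text \<open>Since \<open>flat_exp 1 (n c - 1)\<close> tends to 1 for \<open>c > 0\<close>, these functions converge to the indicator of
  \<open>(a, b)\<close>; the shift by 1 keeps their supports in \<open>[a + 1/n, b - 1/n]\<close>, hence compact in
  \<open>(a, b)\<close>, for \<open>n > 0\<close>.\<close>

definition bump :: "real \<Rightarrow> real \<Rightarrow> nat \<Rightarrow> real \<Rightarrow> real" where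
  "bump a b n s = flat_exp 1 (n * (s - a) - 1) * flat_exp 1 (n * (b - s) - 1)"

lemma flat_exp_1_bounds: "0 \<le> flat_exp 1 s" "flat_exp 1 s \<le> 1"
  by (auto simp: flat_exp_def)

lemma bump_bounds: "0 \<le> bump a b n s" "bump a b n s \<le> 1"
  unfolding bump_def by (auto intro!: mult_nonneg_nonneg mult_le_one flat_exp_1_bounds)

lemma smooth_bump: "smooth (bump a b n)"
proof -
  have affine: "smooth (\<lambda>s. flat_exp 1 (c * s + d))" for c d
    using smooth_flat_exp unfolding smooth_def by (blast intro: diff_times_affine)
  have "bump a b n = (\<lambda>s::real. flat_exp 1 (real n * s + (- real n * a - 1)) * flat_exp 1 ((- real n) * s + (real n * b - 1)))"
    by (auto simp: bump_def algebra_simps)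
  then show ?thesis
    using affine by (simp only: smooth_def diff_times_mult simp_thms)
qed

lemma bump_nonzero:
  assumes "bump a b n s \<noteq> 0" shows "a + 1 / n \<le> s" "s \<le> b - 1 / n" "n > 0"
proof -
  have *: "n * (s - a) - 1 > 0" "n * (b - s) - 1 > 0"
    using assms by (auto simp: bump_def flat_exp_def split: if_splits)
  then show n: "n > 0" by (cases n) auto
  show "a + 1 / n \<le> s" "s \<le> b - 1 / n" using * n by (auto simp: field_simps)
qed

lemma flat_exp_1_tendsto_1:
  assumes "c > 0" shows "(\<lambda>n. flat_exp 1 (real n * c - 1)) \<longlonglongrightarrow> 1"
proof -
  have lim: "filterlim (\<lambda>n. real n * c - 1) at_top sequentially"
  proof -
    have "filterlim (\<lambda>n. real n * c) at_top sequentially"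
      using assms filterlim_real_sequentially
      by (intro filterlim_at_top_mult_tendsto_pos[OF tendsto_const]) auto
    then show ?thesis
      using filterlim_tendsto_add_at_top[OF tendsto_const[of "-1::real"]] by fastforce
  qed
  have "(\<lambda>n. exp (- inverse (real n * c - 1))) \<longlonglongrightarrow> exp (- 0)"
    by (intro tendsto_intros tendsto_inverse_0_at_top lim)
  moreover have "\<forall>\<^sub>F n in sequentially. real n * c - 1 > 0"
    using lim by (rule filterlim_at_top_dense[THEN iffD1, rule_format])
  then have "\<forall>\<^sub>F n in sequentially. exp (- inverse (real n * c - 1)) = flat_exp 1 (real n * c - 1)"
    by eventually_elim (auto simp: flat_exp_def inverse_eq_divide)
  ultimately show ?thesis using tendsto_cong by fastforce
qed

lemma bump_tendsto: "(\<lambda>n. bump a b n s) \<longlonglongrightarrow> indicator {a<..<b} s"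
proof (cases "s \<in> {a<..<b}")
  case True
  then have "(\<lambda>n. bump a b n s) \<longlonglongrightarrow> 1 * 1"
    unfolding bump_def by (intro tendsto_intros flat_exp_1_tendsto_1) auto
  with True show ?thesis by simp
next
  case False
  then have "bump a b n s = 0" for n
    using bump_nonzero[of a b n s] by (smt (verit) divide_nonneg_nonneg greaterThanLessThan_iff
        of_nat_0_le_iff of_nat_0_less_iff zero_less_divide_1_iff)
  with False show ?thesis by simp
qed

lemma box_bump_test_function:
  assumes "box a b \<subseteq> \<Omega>"
  shows "(\<lambda>x. bump (a $ 1) (b $ 1) n (x $ 1) * bump (a $ 2) (b $ 2) n (x $ 2)) \<in> test_functions \<Omega>"
    (is "?\<phi> \<in> _")
proof -
  let ?K = "cbox (a + (\<chi> i. 1 / n)) (b - (\<chi> i. 1 / n))"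
  have supp: "closure {x. ?\<phi> x \<noteq> 0} \<subseteq> ?K"
    by (rule closure_minimal) (auto simp: mem_box_cart forall_2 dest: bump_nonzero)
  have "closure {x. ?\<phi> x \<noteq> 0} \<subseteq> \<Omega>"
  proof (cases "n = 0")
    case True
    then have "{x. ?\<phi> x \<noteq> 0} = {}" by (auto dest: bump_nonzero(3))
    then show ?thesis by simp
  next
    case False
    then have "?K \<subseteq> box a b"
      by (auto simp: mem_box_cart forall_2 dest!: bump_nonzero(3))
         (smt (verit) of_nat_0_less_iff zero_less_divide_1_iff)+
    with supp assms show ?thesis by blast
  qed
  moreover have "compact (closure {x. ?\<phi> x \<noteq> 0})"
    using supp by (meson bounded_cbox bounded_subset closed_closure compact_eq_bounded_closed)
  ultimately show ?thesis
    unfolding test_functions_def using C_k_product[OF smooth_bump smooth_bump] by blast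
qed

text \<open>Open boxes form an intersection-stable generator of the Borel sets, so vanishing of the integral
  propagates from boxes to all Borel sets.\<close>

lemma AE_zero_if_box_integrals_zero:
  fixes h :: "'a::euclidean_space \<Rightarrow> real"
  assumes int: "integrable lborel h"
    and box: "\<And>a b. (\<integral>x. indicator (box a b) x * h x \<partial>lborel) = 0"
  shows "AE x in lborel. h x = 0"
proof (rule density_unique_real[OF int, of "\<lambda>x. 0"])
  let ?E = "range (\<lambda>(a, b). box a b::'a set)"
  have sets: "sets lborel = sigma_sets UNIV ?E"
    unfolding sets_lborel by (subst borel_eq_box) simp
  have stable: "Int_stable ?E" "?E \<subseteq> Pow UNIV" by (auto simp: Int_stable_def box_Int_box)
  fix A :: "'a set" assume "A \<in> sets lborel"
  then have "A \<in> sigma_sets UNIV ?E" by (simp only: sets)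
  with stable have "set_lebesgue_integral lborel A h = 0"
  proof (induction rule: sigma_sets_induct_disjoint)
    case (basic A)
    then show ?case using box by (auto simp: set_lebesgue_integral_def)
  next
    case empty
    show ?case by (simp add: set_lebesgue_integral_def)
  next
    case (compl A)
    have A: "A \<in> sets lborel" using compl(1) by (simp only: sets)
    have "(\<lambda>n. \<integral>x. indicator (box (- (real n *\<^sub>R One)) (real n *\<^sub>R One)) x * h x \<partial>lborel)
        \<longlonglongrightarrow> (\<integral>x. h x \<partial>lborel)"
    proof (rule integral_dominated_convergence[where w = "\<lambda>x. norm (h x)"])
      have "(\<lambda>n. indicator (box (- (real n *\<^sub>R One)) (real n *\<^sub>R One)) x * h x) \<longlonglongrightarrow> h x" for x :: 'a
      proof (rule tendsto_eventually)
        have "x \<in> (\<Union>i::nat. box (- (real i *\<^sub>R One)) (real i *\<^sub>R One))"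
          unfolding UN_box_eq_UNIV by simp
        then obtain N :: nat where N: "x \<in> box (- (real N *\<^sub>R One)) (real N *\<^sub>R One)" by blast
        have "x \<in> box (- (real n *\<^sub>R One)) (real n *\<^sub>R One)" if "n \<ge> N" for n
          unfolding mem_box
        proof
          fix i :: 'a assume i: "i \<in> Basis"
          have "- real N < x \<bullet> i" "x \<bullet> i < real N"
            using N i by (auto simp: mem_box)
          with that i show "- (real n *\<^sub>R One) \<bullet> i < x \<bullet> i \<and> x \<bullet> i < (real n *\<^sub>R One) \<bullet> i"
            by simp
        qed
        then show "\<forall>\<^sub>F n in sequentially. indicator (box (- (real n *\<^sub>R One)) (real n *\<^sub>R One)) x * h x = h x"
          by (auto simp: eventually_sequentially intro!: exI[of _ N])
      qed
      then show "AE x in lborel. (\<lambda>n. indicator (box (- (real n *\<^sub>R One)) (real n *\<^sub>R One)) x * h x) \<longlonglongrightarrow> h x"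
        by simp
    qed (use int in \<open>auto simp: indicator_def\<close>)
    then have "(\<integral>x. h x \<partial>lborel) = 0" using box by (simp add: LIMSEQ_const_iff)
    moreover have "(\<integral>x. h x \<partial>lborel) = set_lebesgue_integral lborel A h + set_lebesgue_integral lborel (UNIV - A) h"
    proof -
      have "set_integrable lborel B h" if "B \<in> sets lborel" for B
        unfolding set_integrable_def by (rule integrable_mult_indicator[OF that int])
      then have "set_lebesgue_integral lborel (A \<union> (UNIV - A)) h
          = set_lebesgue_integral lborel A h + set_lebesgue_integral lborel (UNIV - A) h"
        using A by (intro set_integral_Un) auto
      then show ?thesis by (simp add: set_lebesgue_integral_def)
    qed
    ultimately show ?case using compl by simp
  next
    case (union F)
    have F: "range F \<subseteq> sets lborel" using union(2) by (simp only: sets)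
    have "set_integrable lborel (\<Union>i. F i) h"
      unfolding set_integrable_def by (intro integrable_mult_indicator int sets.countable_UN F)
    then have "set_lebesgue_integral lborel (\<Union>i. F i) h = (\<Sum>i. set_lebesgue_integral lborel (F i) h)"
      using F union(1) by (intro lebesgue_integral_countable_add) (auto simp: disjoint_family_on_def)
    then show ?case using union(3) by simp
  qed
  then show "set_lebesgue_integral lborel A h = set_lebesgue_integral lborel A (\<lambda>x. 0)"
    by (simp add: set_lebesgue_integral_def)
qed simp

text \<open>The fundamental lemma of the calculus of variations. By dominated convergence along the bump functions
  the integral of \<open>g\<close> vanishes over every box inside \<open>\<Omega>\<close>. Inside one such box all sub-boxes are
  again of this kind, which gives \<open>g = 0\<close> there, and countably many boxes exhaust \<open>\<Omega>\<close>.\<close>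

lemma AE_zero_if_orthogonal_to_test_functions:
  fixes g :: scalar_field
  assumes \<Omega>: "open \<Omega>" and g: "integrable (lebesgue_on \<Omega>) g"
    and orth: "\<And>\<phi>. \<phi> \<in> test_functions \<Omega> \<Longrightarrow> (\<integral>x. g x * \<phi> x \<partial>lebesgue_on \<Omega>) = 0"
  shows "AE x in lebesgue_on \<Omega>. g x = 0"
proof -
  have \<Omega>_meas: "\<Omega> \<inter> space lebesgue \<in> sets lebesgue" using \<Omega> by auto
  define G where "G = (\<lambda>x. indicator \<Omega> x * g x)"
  have G: "integrable lebesgue G"
    using g by (simp add: integrable_restrict_space[OF \<Omega>_meas] G_def)
  have box_sets: "box a b \<in> sets lebesgue" for a b :: "real^2"
    by (intro sets_completionI_sets) simp
  have box_meas: "(\<lambda>x. indicator (box a b) x * G x) \<in> borel_measurable lebesgue" for a b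
    by (intro borel_measurable_times borel_measurable_indicator box_sets
        borel_measurable_integrable[OF G])
  have box_zero: "(\<integral>x. indicator (box a b) x * G x \<partial>lebesgue) = 0" if sub: "box a b \<subseteq> \<Omega>" for a b
  proof -
    let ?\<phi> = "\<lambda>n (x::real^2). bump (a $ 1) (b $ 1) n (x $ 1) * bump (a $ 2) (b $ 2) n (x $ 2)"
    have "(\<integral>x. ?\<phi> n x * G x \<partial>lebesgue) = 0" for n
      using orth[OF box_bump_test_function[OF sub, of n]]
      by (simp add: integral_restrict_space[OF \<Omega>_meas] G_def mult_ac)
    moreover have "(\<lambda>n. \<integral>x. ?\<phi> n x * G x \<partial>lebesgue) \<longlonglongrightarrow> (\<integral>x. indicator (box a b) x * G x \<partial>lebesgue)"
    proof (rule integral_dominated_convergence[where w = "\<lambda>x. norm (G x)"])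
      have "(\<lambda>n. ?\<phi> n x * G x) \<longlonglongrightarrow> indicator {a $ 1<..<b $ 1} (x $ 1) * indicator {a $ 2<..<b $ 2} (x $ 2) * G x" for x
        by (intro tendsto_intros bump_tendsto)
      moreover have "indicator {a $ 1<..<b $ 1} (x $ 1) * indicator {a $ 2<..<b $ 2} (x $ 2) = (indicator (box a b) x :: real)" for x
        by (auto simp: indicator_def mem_box_cart forall_2)
      ultimately show "AE x in lebesgue. (\<lambda>n. ?\<phi> n x * G x) \<longlonglongrightarrow> indicator (box a b) x * G x"
        by simp
      show "(\<lambda>x. ?\<phi> n x * G x) \<in> borel_measurable lebesgue" for n
      proof -
        have "continuous_on UNIV (?\<phi> n)" using C_k_product[OF smooth_bump smooth_bump, of 0] by simp
        then have "?\<phi> n \<in> borel_measurable lebesgue"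
          by (intro measurable_completion) (simp add: borel_measurable_continuous_onI)
        then show ?thesis
          by (rule borel_measurable_times) (rule borel_measurable_integrable[OF G])
      qed
      show "AE x in lebesgue. norm (?\<phi> n x * G x) \<le> norm (G x)" for n
      proof (intro always_eventually allI)
        fix x
        have "\<bar>?\<phi> n x\<bar> \<le> 1" by (simp add: abs_mult mult_le_one bump_bounds)
        then show "norm (?\<phi> n x * G x) \<le> norm (G x)"
          by (metis abs_mult abs_ge_zero mult_left_le_one_le real_norm_def)
      qed
    qed (use G box_meas in auto)
    ultimately show ?thesis by (simp add: LIMSEQ_const_iff)
  qed
  have zero_on_box: "AE x in lebesgue. x \<in> box a b \<longrightarrow> g x = 0" if sub: "box a b \<subseteq> \<Omega>" for a b
  proof -
    obtain h where h: "h \<in> borel_measurable lborel" "AE x in lborel. indicator (box a b) x * G x = h x"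
      using completion_ex_borel_measurable_real[OF box_meas] by blast
    have h_ae: "AE x in lebesgue. indicator (box a b) x * G x = h x"
      using h(2) by (rule AE_completion)
    have "integrable lebesgue h"
      using integrable_cong_AE[THEN iffD1, OF _ _ h_ae] integrable_mult_indicator[OF box_sets G, of a b] h(1) box_meas
      by (auto simp: measurable_completion)
    then have h_int: "integrable lborel h" using h(1) by (simp add: integrable_completion)
    have "(\<integral>x. indicator (box c d) x * h x \<partial>lborel) = 0" for c d
    proof -
      have "(\<integral>x. indicator (box c d) x * h x \<partial>lborel) = (\<integral>x. indicator (box c d) x * h x \<partial>lebesgue)"
        using h(1) by (intro integral_completion[symmetric]) auto
      also have "\<dots> = (\<integral>x. indicator (box a b \<inter> box c d) x * G x \<partial>lebesgue)"
      proof (rule integral_cong_AE)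
        show "AE x in lebesgue. indicator (box c d) x * h x = indicator (box a b \<inter> box c d) x * G x"
          using h_ae by eventually_elim (auto simp: indicator_def)
        show "(\<lambda>x. indicator (box c d) x * h x) \<in> borel_measurable lebesgue"
          by (rule measurable_completion) (use h(1) in auto)
        show "(\<lambda>x. indicator (box a b \<inter> box c d) x * G x) \<in> borel_measurable lebesgue"
          unfolding box_Int_box by (rule box_meas)
      qed
      also have "\<dots> = 0"
        unfolding box_Int_box by (rule box_zero) (use sub in \<open>auto simp: box_Int_box[symmetric]\<close>)
      finally show ?thesis .
    qed
    then have "AE x in lebesgue. h x = 0"
      using AE_zero_if_box_integrals_zero[OF h_int] AE_completion by blast
    with h_ae show ?thesis
      by eventually_elim (use sub in \<open>auto simp: G_def indicator_def split: if_splits\<close>)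
  qed
  obtain \<D> where \<D>: "countable \<D>" "\<D> \<subseteq> Pow \<Omega>" "\<And>X. X \<in> \<D> \<Longrightarrow> \<exists>a b. X = box a b" "\<Union>\<D> = \<Omega>"
    using open_countable_Union_open_box[OF \<Omega>] by blast
  have "AE x in lebesgue. \<forall>X\<in>\<D>. x \<in> X \<longrightarrow> g x = 0"
  proof (subst AE_ball_countable[OF \<D>(1)], intro ballI)
    fix X assume "X \<in> \<D>"
    with \<D>(2,3) zero_on_box show "AE x in lebesgue. x \<in> X \<longrightarrow> g x = 0" by blast
  qed
  then have "AE x in lebesgue. x \<in> \<Omega> \<longrightarrow> g x = 0"
    by eventually_elim (use \<D>(4) in blast)
  then show ?thesis by (simp add: AE_restrict_space_iff[OF \<Omega>_meas])
qed

section \<open>Semi-inner products on spaces of functions\<close>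

text \<open>Fields are functions that matter only up to null sets and the sets at hand are not types, so linear
  structure is expressed by closure under pointwise linear combinations.\<close>

definition function_subspace :: "('a \<Rightarrow> 'b::real_vector) set \<Rightarrow> bool" where
  "function_subspace Z \<longleftrightarrow> Z \<noteq> {} \<and>
     (\<forall>u\<in>Z. \<forall>v\<in>Z. \<forall>a b. (\<lambda>x. a *\<^sub>R u x + b *\<^sub>R v x) \<in> Z)"

lemma function_subspaceD:
  assumes "function_subspace Z"
  shows "u \<in> Z \<Longrightarrow> v \<in> Z \<Longrightarrow> (\<lambda>x. a *\<^sub>R u x + b *\<^sub>R v x) \<in> Z"
    and "u \<in> Z \<Longrightarrow> v \<in> Z \<Longrightarrow> (\<lambda>x. u x - v x) \<in> Z"
    and "u \<in> Z \<Longrightarrow> (\<lambda>x. a *\<^sub>R u x) \<in> Z"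
    and "(\<lambda>x. 0) \<in> Z"
proof -
  show *: "(\<lambda>x. a *\<^sub>R u x + b *\<^sub>R v x) \<in> Z" if "u \<in> Z" "v \<in> Z" for u v a b
    using assms that unfolding function_subspace_def by blast
  show "(\<lambda>x. u x - v x) \<in> Z" if "u \<in> Z" "v \<in> Z" using *[OF that, of 1 "-1"] by simp
  show "(\<lambda>x. a *\<^sub>R u x) \<in> Z" if "u \<in> Z" using *[OF that that, of a 0] by simp
  obtain u where "u \<in> Z" using assms unfolding function_subspace_def by blast
  then show "(\<lambda>x. 0) \<in> Z" using *[of u u 0 0] by simp
qed

text \<open>The forms are semidefinite rather than definite: fields that vanish almost everywhere have norm 0, and
  \<open>(div u, div v)\<close> is degenerate on divergence-free fields.\<close>

locale semi_inner_space =
  fixes X :: "('a \<Rightarrow> 'b::real_vector) set" and B :: "('a \<Rightarrow> 'b) \<Rightarrow> ('a \<Rightarrow> 'b) \<Rightarrow> real"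
  assumes subspace: "function_subspace X"
    and lincomb: "u \<in> X \<Longrightarrow> v \<in> X \<Longrightarrow> w \<in> X \<Longrightarrow>
      B (\<lambda>x. a *\<^sub>R u x + b *\<^sub>R v x) w = a * B u w + b * B v w"
    and sym: "u \<in> X \<Longrightarrow> v \<in> X \<Longrightarrow> B u v = B v u"
    and nonneg: "u \<in> X \<Longrightarrow> 0 \<le> B u u"
begin

definition N where "N u = sqrt (B u u)"

lemmas in_X = function_subspaceD[OF subspace]

lemma lincomb_right:
  "u \<in> X \<Longrightarrow> v \<in> X \<Longrightarrow> w \<in> X \<Longrightarrow>
    B w (\<lambda>x. a *\<^sub>R u x + b *\<^sub>R v x) = a * B w u + b * B w v"
  using lincomb[of u v w a b] sym[of w u] sym[of w v] in_X(1)[of u v a b]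
    sym[of w "\<lambda>x. a *\<^sub>R u x + b *\<^sub>R v x"] by simp

lemma diff: "u \<in> X \<Longrightarrow> v \<in> X \<Longrightarrow> w \<in> X \<Longrightarrow> B (\<lambda>x. u x - v x) w = B u w - B v w"
  using lincomb[of u v w 1 "-1"] by simp

lemma diff_right: "u \<in> X \<Longrightarrow> v \<in> X \<Longrightarrow> w \<in> X \<Longrightarrow> B w (\<lambda>x. u x - v x) = B w u - B w v"
  using lincomb_right[of u v w 1 "-1"] by simp

lemma scale: "u \<in> X \<Longrightarrow> w \<in> X \<Longrightarrow> B (\<lambda>x. a *\<^sub>R u x) w = a * B u w"
  using lincomb[of u u w a 0] by simp

lemma N_nonneg: "u \<in> X \<Longrightarrow> 0 \<le> N u" by (simp add: N_def nonneg)

lemma N_squared: "u \<in> X \<Longrightarrow> (N u)\<^sup>2 = B u u" by (simp add: N_def nonneg)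

lemma Cauchy_Schwarz:
  assumes u: "u \<in> X" and v: "v \<in> X"
  shows "\<bar>B u v\<bar> \<le> N u * N v"
proof -
  have quad: "0 \<le> B u u + 2 * s * B u v + s\<^sup>2 * B v v" for s
    using nonneg[OF in_X(1)[OF u v, of 1 s]] u v in_X(1)[OF u v, of 1 s] sym[OF u v]
    by (simp add: lincomb lincomb_right algebra_simps power2_eq_square
          del: scaleR_one)
  have "(B u v)\<^sup>2 \<le> B u u * B v v"
  proof (cases "B v v = 0")
    case True
    have "B u v = 0"
    proof (rule ccontr)
      assume "B u v \<noteq> 0"
      \<comment> \<open>At this value of \<open>s\<close> the quadratic, now linear, equals \<open>-1\<close>.\<close>
      with quad[of "- (B u u + 1) / (2 * B u v)"] True show False by (simp add: field_simps)
    qed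
    with True show ?thesis by simp
  next
    case False
    with nonneg[OF v] have "B v v > 0" by simp
    \<comment> \<open>The quadratic is smallest at this \<open>s\<close>.\<close>
    with quad[of "- B u v / B v v"] show ?thesis
      by (simp add: field_simps power2_eq_square)
  qed
  then have "sqrt ((B u v)\<^sup>2) \<le> sqrt (B u u * B v v)" by (rule real_sqrt_le_mono)
  then show ?thesis by (simp add: N_def real_sqrt_mult)
qed

lemma B_null: "u \<in> X \<Longrightarrow> v \<in> X \<Longrightarrow> B v v = 0 \<Longrightarrow> B u v = 0"
  using Cauchy_Schwarz[of u v] by (simp add: N_def)

text \<open>Finite dimension modulo null vectors is expressed by a linear relation \<open>R\<close> between vectors and
  coefficient families on a finite set \<open>J\<close> in which zero coefficients force a null vector; no basis of
  \<open>Z\<close> has to be chosen. Induction on \<open>J\<close>: vectors with vanishing \<open>j\<close>-th coefficient form a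
  subspace \<open>Z'\<close> of codimension at most one, and Gram-Schmidt adds the missing direction.\<close>

lemma ex_orthogonal_projection:
  assumes "finite J" "function_subspace Z" "Z \<subseteq> X"
    and "\<And>u v c d a b. R u c \<Longrightarrow> R v d \<Longrightarrow> R (\<lambda>x. a *\<^sub>R u x + b *\<^sub>R v x) (\<lambda>j. a * c j + b * d j)"
    and "\<And>u. u \<in> Z \<Longrightarrow> \<exists>c. R u c"
    and "\<And>u c. u \<in> Z \<Longrightarrow> R u c \<Longrightarrow> (\<forall>j\<in>J. c j = 0) \<Longrightarrow> B u u = 0"
    and "w \<in> X"
  shows "\<exists>p\<in>Z. \<forall>z\<in>Z. B (\<lambda>x. w x - p x) z = 0"
  using assms
proof (induction J arbitrary: Z R w rule: finite_induct)
  case empty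
  have "B (\<lambda>x. w x - 0) z = 0" if "z \<in> Z" for z
    using empty(4)[OF that] empty(5)[OF that] that \<open>Z \<subseteq> X\<close> \<open>w \<in> X\<close> B_null[of w z] by auto
  with function_subspaceD(4)[OF empty(1)] show ?case by force
next
  case (insert j J)
  note Z = function_subspaceD[OF insert.prems(1)]
  note ZX = subsetD[OF \<open>Z \<subseteq> X\<close>]
  note R_lin = insert.prems(3) and R_total = insert.prems(4) and R_zero = insert.prems(5)
  define R' where "R' = (\<lambda>u c. R u c \<and> c j = (0::real))"
  define Z' where "Z' = {z \<in> Z. \<exists>c. R' z c}"
  have Z'Z: "Z' \<subseteq> Z" by (auto simp: Z'_def)
  have R'_lin: "R' (\<lambda>x. a *\<^sub>R u x + b *\<^sub>R v x) (\<lambda>j. a * c j + b * d j)" if "R' u c" "R' v d" for u v c d a b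
    using that R_lin unfolding R'_def by simp
  obtain c where "R (\<lambda>x. 0) c" using R_total[OF Z(4)] by blast
  from R_lin[OF this this, of 0 0] have "(\<lambda>x. 0) \<in> Z'"
    using Z(4) by (auto simp: Z'_def R'_def)
  moreover have "(\<lambda>x. a *\<^sub>R u x + b *\<^sub>R v x) \<in> Z'" if "u \<in> Z'" "v \<in> Z'" for u v a b
    using that R'_lin Z(1) unfolding Z'_def by blast
  ultimately have Z'_sub: "function_subspace Z'" unfolding function_subspace_def by blast
  have proj: "\<exists>p\<in>Z'. \<forall>z\<in>Z'. B (\<lambda>x. w x - p x) z = 0" if "w \<in> X" for w
  proof (rule insert.IH[OF Z'_sub _ _ _ _ that, of R'])
    show "Z' \<subseteq> X" using Z'Z ZX by blast
    show "\<exists>c. R' u c" if "u \<in> Z'" for u using that by (auto simp: Z'_def)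
    show "B u u = 0" if "u \<in> Z'" "R' u c" "\<forall>j\<in>J. c j = 0" for u c
      using that R_zero[of u c] Z'Z by (auto simp: R'_def)
  qed (rule R'_lin)
  show ?case
  proof (cases "\<exists>z0\<in>Z. \<exists>c. R z0 c \<and> c j \<noteq> 0")
    case False
    with R_total have "Z' = Z" by (fastforce simp: Z'_def R'_def)
    with proj[OF \<open>w \<in> X\<close>] show ?thesis by simp
  next
    case True
    then obtain z0 c0 where z0: "z0 \<in> Z" "R z0 c0" "c0 j \<noteq> 0" by blast
    obtain q where q: "q \<in> Z'" "\<And>z. z \<in> Z' \<Longrightarrow> B (\<lambda>x. z0 x - q x) z = 0"
      using proj[OF ZX[OF z0(1)]] by blast
    define z1 where "z1 = (\<lambda>x. z0 x - q x)"
    have z1: "z1 \<in> Z" unfolding z1_def using Z(2) z0(1) q(1) Z'Z by blast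
    have z1_orth: "B z1 z = 0" if "z \<in> Z'" for z using q(2)[OF that] by (simp add: z1_def)
    obtain p' where p': "p' \<in> Z'" "\<And>z. z \<in> Z' \<Longrightarrow> B (\<lambda>x. w x - p' x) z = 0"
      using proj[OF \<open>w \<in> X\<close>] by blast
    \<comment> \<open>If \<open>z1\<close> is a null vector then \<open>B w z1 = 0\<close>, and the default value \<open>k = 0\<close> of the division is right.\<close>
    define k where "k = B w z1 / B z1 z1"
    have k: "k * B z1 z1 = B w z1"
      using B_null[OF \<open>w \<in> X\<close> ZX[OF z1]] by (cases "B z1 z1 = 0") (auto simp: k_def)
    define p where "p = (\<lambda>x. 1 *\<^sub>R p' x + k *\<^sub>R z1 x)"
    have mem: "w \<in> X" "p' \<in> X" "z1 \<in> X" "p' \<in> Z" using \<open>w \<in> X\<close> p'(1) z1 Z'Z ZX by auto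
    have pZ: "p \<in> Z" unfolding p_def by (rule Z(1)[OF mem(4) z1])
    have split: "B (\<lambda>x. w x - p x) z = B (\<lambda>x. w x - p' x) z - k * B z1 z" if "z \<in> X" for z
      using that mem ZX[OF pZ] lincomb[OF mem(2,3) that, of 1 k] by (simp add: diff p_def)
    have "B (\<lambda>x. w x - p x) z = 0" if z: "z \<in> Z" for z
    proof -
      obtain c where c: "R z c" using R_total[OF z] by blast
      define s where "s = c j / c0 j"
      have "(\<lambda>x. 1 *\<^sub>R z x + (- s) *\<^sub>R z0 x) \<in> Z'"
        using R_lin[OF c z0(2), of 1 "- s"] Z(1)[OF z z0(1), of 1 "- s"] z0(3)
        by (auto simp: Z'_def R'_def s_def intro!: exI[of _ "\<lambda>i. 1 * c i + - s * c0 i"])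
      from function_subspaceD(1)[OF Z'_sub this q(1), of 1 s]
      have z2: "(\<lambda>x. z x - s *\<^sub>R z1 x) \<in> Z'" (is "?z2 \<in> _")
        by (simp add: z1_def algebra_simps)
      have "z = (\<lambda>x. 1 *\<^sub>R ?z2 x + s *\<^sub>R z1 x)" by (simp add: fun_eq_iff)
      then have "B (\<lambda>x. w x - p x) z = B (\<lambda>x. w x - p x) ?z2 + s * B (\<lambda>x. w x - p x) z1"
        using lincomb_right[of ?z2 z1 "\<lambda>x. w x - p x" 1 s] z2 Z'Z ZX mem in_X(2)[OF mem(1) ZX[OF pZ]]
        by auto
      moreover have "B (\<lambda>x. w x - p x) ?z2 = 0"
        using split[of ?z2] p'(2)[OF z2] z1_orth[OF z2] z2 Z'Z ZX by auto
      moreover have "B (\<lambda>x. w x - p x) z1 = 0"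
        using split[OF mem(3)] mem k z1_orth[OF p'(1)] sym[of p' z1] by (simp add: diff)
      ultimately show ?thesis by simp
    qed
    with pZ show ?thesis by blast
  qed
qed

definition curve_derivative ::
    "real set \<Rightarrow> (real \<Rightarrow> 'a \<Rightarrow> 'b) \<Rightarrow> real \<Rightarrow> ('a \<Rightarrow> 'b) \<Rightarrow> bool" where
  "curve_derivative S u t u' \<longleftrightarrow>
     ((\<lambda>s. N (\<lambda>x. (u s x - u t x) /\<^sub>R (s - t) - u' x)) \<longlongrightarrow> 0) (at t within S)"

text \<open>Writing \<open>u s = u t + (s - t)(u' + q s)\<close> and likewise \<open>v s\<close> with remainder \<open>r s\<close>, the difference
  quotient is a polynomial in \<open>s - t\<close> and in products with \<open>q\<close> and \<open>r\<close>, which tend to 0 by the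
  Cauchy-Schwarz inequality.\<close>

lemma product_rule:
  assumes X: "\<And>s. s \<in> S \<Longrightarrow> u s \<in> X" "\<And>s. s \<in> S \<Longrightarrow> v s \<in> X" "u' \<in> X" "v' \<in> X" "t \<in> S"
    and u': "curve_derivative S u t u'" and v': "curve_derivative S v t v'"
  shows "((\<lambda>s. B (u s) (v s)) has_real_derivative (B u' (v t) + B (u t) v')) (at t within S)"
proof -
  define q where "q = (\<lambda>s x. (u s x - u t x) /\<^sub>R (s - t) - u' x)"
  define r where "r = (\<lambda>s x. (v s x - v t x) /\<^sub>R (s - t) - v' x)"
  have q: "q s \<in> X" and r: "r s \<in> X" if "s \<in> S" for s
    unfolding q_def r_def using X that by (auto intro!: in_X(2,3))
  have ev: "\<forall>\<^sub>F s in at t within S. s \<in> S \<and> s \<noteq> t"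
    by (auto simp: eventually_at_filter)
  have Nq: "((\<lambda>s. N (q s)) \<longlongrightarrow> 0) (at t within S)" and Nr: "((\<lambda>s. N (r s)) \<longlongrightarrow> 0) (at t within S)"
    using u' v' by (auto simp: curve_derivative_def q_def r_def)
  have lim: "((\<lambda>s. B (f s) (g s)) \<longlongrightarrow> 0) (at t within S)"
    if "((\<lambda>s. N (f s) * N (g s)) \<longlongrightarrow> 0) (at t within S)" "\<And>s. s \<in> S \<Longrightarrow> f s \<in> X" "\<And>s. s \<in> S \<Longrightarrow> g s \<in> X"
    for f g
  proof (rule Lim_null_comparison[OF _ that(1)])
    show "\<forall>\<^sub>F s in at t within S. norm (B (f s) (g s)) \<le> N (f s) * N (g s)"
      using ev by eventually_elim (use that Cauchy_Schwarz in simp)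
  qed
  have lim_q: "((\<lambda>s. B (q s) g) \<longlongrightarrow> 0) (at t within S)" if "g \<in> X" for g
    using lim[of q "\<lambda>_. g"] tendsto_mult_left_zero[OF Nq] q that by simp
  have lim_r: "((\<lambda>s. B g (r s)) \<longlongrightarrow> 0) (at t within S)" if "g \<in> X" for g
    using lim[of "\<lambda>_. g" r] tendsto_mult_right_zero[OF Nr] r that by simp
  have lim_qr: "((\<lambda>s. B (q s) (r s)) \<longlongrightarrow> 0) (at t within S)"
    using lim[of q r] tendsto_mult_zero[OF Nq Nr] q r by simp
  have id: "((\<lambda>s. s - t) \<longlongrightarrow> 0) (at t within S)"
    by (rule tendsto_eq_intros refl | simp)+
  let ?Q = "\<lambda>s. B u' (v t) + B (u t) v' + (B (q s) (v t) + B (u t) (r s)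
      + (s - t) * (B u' v' + B u' (r s) + B (q s) v' + B (q s) (r s)))"
  have "(?Q \<longlongrightarrow> B u' (v t) + B (u t) v' + (0 + 0 + 0 * (B u' v' + 0 + 0 + 0))) (at t within S)"
    by (intro tendsto_intros id lim_q lim_r lim_qr X)
  then have "(?Q \<longlongrightarrow> B u' (v t) + B (u t) v') (at t within S)" by simp
  moreover have "\<forall>\<^sub>F s in at t within S. (B (u s) (v s) - B (u t) (v t)) / (s - t) = ?Q s"
    using ev
  proof eventually_elim
    case (elim s)
    then have s: "s \<in> S" "s - t \<noteq> 0" by auto
    have us: "u s = (\<lambda>x. 1 *\<^sub>R u t x + (s - t) *\<^sub>R (1 *\<^sub>R u' x + 1 *\<^sub>R q s x))"
      using s(2) by (simp add: q_def)
    have vs: "v s = (\<lambda>x. 1 *\<^sub>R v t x + (s - t) *\<^sub>R (1 *\<^sub>R v' x + 1 *\<^sub>R r s x))"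
      using s(2) by (simp add: r_def)
    have mem: "u t \<in> X" "u' \<in> X" "q s \<in> X" "v t \<in> X" "v' \<in> X" "r s \<in> X"
      using X q r s by auto
    note mem' = in_X(1)[OF mem(2,3), of 1 1] in_X(1)[OF mem(5,6), of 1 1]
    have Bu: "B (u s) w = B (u t) w + (s - t) * (B u' w + B (q s) w)" if "w \<in> X" for w
      by (subst us, subst lincomb[OF mem(1) mem'(1) that], subst lincomb[OF mem(2,3) that]) simp
    have Bv: "B w (v s) = B w (v t) + (s - t) * (B w v' + B w (r s))" if "w \<in> X" for w
      by (subst vs, subst lincomb_right[OF mem(4) mem'(2) that], subst lincomb_right[OF mem(5,6) that]) simp
    have "B (u s) (v s) - B (u t) (v t) = (s - t) * ?Q s"
      using X(2)[OF s(1)] mem by (simp add: Bu Bv algebra_simps)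
    with s(2) show ?case by simp
  qed
  ultimately show ?thesis
    unfolding has_field_derivative_iff by (simp add: tendsto_cong)
qed

lemma orthogonal_part_le:
  assumes "q \<in> X" "Z \<subseteq> X" "\<zeta> \<in> Z" "\<And>z. z \<in> Z \<Longrightarrow> B (\<lambda>x. q x - \<zeta> x) z = 0"
  shows "N (\<lambda>x. q x - \<zeta> x) \<le> N q"
proof -
  let ?d = "\<lambda>x. q x - \<zeta> x"
  have mem: "\<zeta> \<in> X" "?d \<in> X" using assms in_X(2) by auto
  have "N ?d * N ?d = B q ?d - B \<zeta> ?d"
    using N_squared[OF mem(2)] diff[OF assms(1) mem(1) mem(2)] by (simp add: power2_eq_square)
  also have "B \<zeta> ?d = 0" using assms(3,4) sym[OF mem] by simp
  also have "B q ?d - 0 \<le> N q * N ?d" using Cauchy_Schwarz[OF assms(1) mem(2)] by simp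
  finally show ?thesis using N_nonneg[OF mem(2)] N_nonneg[OF assms(1)] by (metis mult_right_le_imp_le order_le_less)
qed

text \<open>The part of a vector orthogonal to \<open>Z\<close> is determined only up to null vectors, so \<open>p\<close> is an
  arbitrary choice of projection. The remainder of the orthogonal parts is still the
  orthogonal part of the remainder for some element of \<open>Z\<close>, hence no larger in norm.\<close>

lemma curve_derivative_orthogonal_part:
  assumes Z: "function_subspace Z" "Z \<subseteq> X"
    and p: "\<And>w. w \<in> X \<Longrightarrow> p w \<in> Z" "\<And>w z. w \<in> X \<Longrightarrow> z \<in> Z \<Longrightarrow> B (\<lambda>x. w x - p w x) z = 0"
    and u: "\<And>s. s \<in> S \<Longrightarrow> u s \<in> X" "u' \<in> X" "t \<in> S" "curve_derivative S u t u'"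
  shows "curve_derivative S (\<lambda>s x. u s x - p (u s) x) t (\<lambda>x. u' x - p u' x)"
proof -
  have "\<forall>\<^sub>F s in at t within S. norm (N (\<lambda>x. ((u s x - p (u s) x) - (u t x - p (u t) x)) /\<^sub>R (s - t) - (u' x - p u' x)))
      \<le> N (\<lambda>x. (u s x - u t x) /\<^sub>R (s - t) - u' x)"
    unfolding eventually_at_filter
  proof (intro always_eventually allI impI)
    fix s assume s: "s \<in> S"
    let ?q = "\<lambda>x. (u s x - u t x) /\<^sub>R (s - t) - u' x"
    let ?z = "\<lambda>x. (p (u s) x - p (u t) x) /\<^sub>R (s - t) - p u' x"
    let ?w = "\<lambda>w x. w x - p w x"
    have X: "u s \<in> X" "u t \<in> X" "u' \<in> X" using u s by auto
    then have w: "?w (u s) \<in> X" "?w (u t) \<in> X" "?w u' \<in> X" "\<And>x. x \<in> Z \<Longrightarrow> x \<in> X"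
      using p(1) Z(2) by (auto intro!: in_X(2))
    have eq: "(\<lambda>x. ((u s x - p (u s) x) - (u t x - p (u t) x)) /\<^sub>R (s - t) - (u' x - p u' x)) = (\<lambda>x. ?q x - ?z x)"
      by (simp add: algebra_simps fun_eq_iff)
    have "?q \<in> X" using X by (intro in_X(2,3))
    moreover have "?z \<in> Z" using X p(1) by (intro function_subspaceD(2,3)[OF Z(1)])
    moreover have "B (\<lambda>x. ?q x - ?z x) z = 0" if "z \<in> Z" for z
      unfolding eq[symmetric]
      using p(2)[OF X(1) that] p(2)[OF X(2) that] p(2)[OF X(3) that] that w in_X(2)[OF w(1,2)]
        in_X(3)[OF in_X(2)[OF w(1,2)]]
      by (simp add: diff scale)
    ultimately have "N (\<lambda>x. ?q x - ?z x) \<le> N ?q" "0 \<le> N (\<lambda>x. ?q x - ?z x)"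
      using orthogonal_part_le[OF _ Z(2), of ?q ?z] N_nonneg[OF in_X(2)[of ?q ?z]] Z(2) by auto
    then show "norm (N (\<lambda>x. ((u s x - p (u s) x) - (u t x - p (u t) x)) /\<^sub>R (s - t) - (u' x - p u' x))) \<le> N ?q"
      unfolding eq by simp
  qed
  then show ?thesis
    unfolding curve_derivative_def
    by (rule Lim_null_comparison) (use u(4) in \<open>simp add: curve_derivative_def\<close>)
qed

end

section \<open>Energy decay for abstract damped wave equations\<close>

text \<open>The function \<open>L s exp (k s)\<close> has nonpositive derivative; the derivative at 0 is one-sided, hence the
  mean value theorem relative to the interval.\<close>

lemma exponential_decay_if_derivative_le:
  fixes L L' :: "real \<Rightarrow> real"
  assumes "\<And>s. s \<ge> 0 \<Longrightarrow> (L has_real_derivative L' s) (at s within {0..})"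
    and "\<And>s. s \<ge> 0 \<Longrightarrow> L' s \<le> - k * L s" and "t \<ge> 0"
  shows "L t \<le> L 0 * exp (- k * t)"
proof -
  let ?g = "\<lambda>s. L s * exp (k * s)"
  let ?g' = "\<lambda>s. L' s * exp (k * s) + (exp (k * s) * k) * L s"
  have "(?g has_derivative (*) (?g' s)) (at s within {0..t})" if "0 \<le> s" "s \<le> t" for s
  proof -
    have "(L has_real_derivative L' s) (at s within {0..t})"
      by (rule has_field_derivative_subset[OF assms(1)[OF that(1)]]) auto
    moreover have "((\<lambda>s. exp (k * s)) has_real_derivative exp (k * s) * k) (at s within {0..t})"
      by (auto intro!: derivative_eq_intros)
    ultimately have "(?g has_real_derivative ?g' s) (at s within {0..t})"
      by (rule DERIV_mult)
    then show ?thesis by (simp add: has_field_derivative_def)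
  qed
  from mvt_very_simple[OF assms(3) this] obtain s where
    s: "s \<in> {0..t}" "?g t - ?g 0 = ?g' s * (t - 0)" by blast
  have "?g' s = exp (k * s) * (L' s + k * L s)" by (simp add: algebra_simps)
  also have "\<dots> \<le> 0" using assms(2)[of s] s(1) by (intro mult_nonneg_nonpos) auto
  finally have "?g' s * (t - 0) \<le> 0" using assms(3) by (intro mult_nonpos_nonneg) auto
  with s(2) have "L t * exp (k * t) \<le> L 0" by simp
  then show ?thesis by (simp add: exp_minus field_simps)
qed

context semi_inner_space
begin

text \<open>The abstract form of the energy argument. Here \<open>B\<close> is the kinetic and \<open>D\<close> the potential form,
  \<open>K\<close> collects the rotation and damping terms, \<open>Z\<close> stands for the divergence-free fields and \<open>M\<close> is the
  Poincare-Friedrichs constant relative to \<open>D\<close>.\<close>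

lemma damped_wave_energy_decay:
  fixes D K :: "('a \<Rightarrow> 'b) \<Rightarrow> ('a \<Rightarrow> 'b) \<Rightarrow> real"
    and u ut utt :: "real \<Rightarrow> 'a \<Rightarrow> 'b"
  assumes D: "semi_inner_space X D"
    and Z: "function_subspace Z" "Z \<subseteq> X" "\<And>z. z \<in> Z \<Longrightarrow> D z z = 0"
    and ex_proj: "\<And>w. w \<in> X \<Longrightarrow> \<exists>p\<in>Z. \<forall>z\<in>Z. B (\<lambda>x. w x - p x) z = 0"
    and friedrichs: "\<And>w p. w \<in> X \<Longrightarrow> p \<in> Z \<Longrightarrow> (\<forall>z\<in>Z. B (\<lambda>x. w x - p x) z = 0) \<Longrightarrow>
      N (\<lambda>x. w x - p x) \<le> M * sqrt (D w w)"
    and K_coercive: "\<And>w. w \<in> X \<Longrightarrow> c * B w w \<le> K w w"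
    and K_bounded: "\<And>w v. w \<in> X \<Longrightarrow> v \<in> X \<Longrightarrow> \<bar>K w v\<bar> \<le> k * (N w * N v)"
    and X: "\<And>s. s \<ge> 0 \<Longrightarrow> u s \<in> X" "\<And>s. s \<ge> 0 \<Longrightarrow> ut s \<in> X" "\<And>s. s \<ge> 0 \<Longrightarrow> utt s \<in> X"
    and u: "\<And>s. s \<ge> 0 \<Longrightarrow> curve_derivative {0..} u s (ut s)"
    and ut: "\<And>s. s \<ge> 0 \<Longrightarrow> curve_derivative {0..} ut s (utt s)"
    and uD: "\<And>s. s \<ge> 0 \<Longrightarrow> semi_inner_space.curve_derivative D {0..} u s (ut s)"
    and eqn: "\<And>s v. s \<ge> 0 \<Longrightarrow> v \<in> X \<Longrightarrow> B (utt s) v + K (ut s) v + \<gamma> * D (u s) v = 0"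
    and pos: "\<gamma> > 0" "M > 0" "k \<ge> 0" "\<alpha> > 0"
    and chi_eq: "chi = 2 + M\<^sup>2 * k\<^sup>2 / \<gamma>"
    and \<alpha>: "\<alpha> \<le> sqrt \<gamma> / (2 * M)" "\<alpha> \<le> 2 * c / (1 + chi)"
    and E: "\<And>s. E s = 1 / 2 * B (ut s) (ut s) + \<gamma> / 2 * D (u s) (u s)"
    and t: "t \<ge> 0"
  shows "E t \<le> 3 * E 0 * exp (- (2 * \<alpha> / 3) * t)"
proof -
  interpret D: semi_inner_space X D by (rule D)
  have "\<forall>w\<in>X. \<exists>p. p \<in> Z \<and> (\<forall>z\<in>Z. B (\<lambda>x. w x - p x) z = 0)"
    using ex_proj by blast
  from bchoice[OF this] obtain p where
    p: "\<And>w. w \<in> X \<Longrightarrow> p w \<in> Z" "\<And>w z. w \<in> X \<Longrightarrow> z \<in> Z \<Longrightarrow> B (\<lambda>x. w x - p w x) z = 0"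
    by blast
  \<comment> \<open>The orthogonal part, \<open>u\<^sup>D\<close> in the application.\<close>
  define dv where "dv = (\<lambda>w x. w x - p w x)"
  have dv: "dv w \<in> X" if "w \<in> X" for w
    unfolding dv_def using that p(1) Z(2) by (auto intro!: in_X(2))
  have dv_le: "N (dv w) \<le> N w" if "w \<in> X" for w
    unfolding dv_def by (rule orthogonal_part_le[OF that Z(2) p(1)[OF that] p(2)[OF that]])
  have dv_friedrichs: "N (dv w) \<le> M * sqrt (D w w)" if "w \<in> X" for w
    unfolding dv_def using friedrichs[OF that p(1)[OF that]] p(2)[OF that] by blast
  define a where "a = (\<lambda>s. N (ut s))"
  define d where "d = (\<lambda>s. sqrt \<gamma> * sqrt (D (u s) (u s)))"
  have a: "B (ut s) (ut s) = (a s)\<^sup>2" "a s \<ge> 0" if "s \<ge> 0" for s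
    using that X by (auto simp: a_def N_squared N_nonneg)
  have d: "\<gamma> * D (u s) (u s) = (d s)\<^sup>2" "d s \<ge> 0" if "s \<ge> 0" for s
    using that X pos D.nonneg by (auto simp: d_def power_mult_distrib)
  have E_eq: "E s = ((a s)\<^sup>2 + (d s)\<^sup>2) / 2" if "s \<ge> 0" for s
    using a[OF that] d[OF that] E[of s] by simp
  have dv_u: "N (dv (u s)) \<le> M / sqrt \<gamma> * d s" if "s \<ge> 0" for s
    using dv_friedrichs[OF X(1)[OF that]] pos by (simp add: d_def)
  define G where "G = (\<lambda>s. B (ut s) (dv (u s)))"
  \<comment> \<open>The perturbed energy: it is equivalent to \<open>E\<close>, and its derivative also controls \<open>D\<close>.\<close>
  define L where "L = (\<lambda>s. E s + \<alpha> * G s)"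
  have G_le: "\<bar>\<alpha> * G s\<bar> \<le> E s / 2" if "s \<ge> 0" for s
  proof -
    have "\<bar>G s\<bar> \<le> a s * N (dv (u s))"
      unfolding G_def a_def by (rule Cauchy_Schwarz[OF X(2)[OF that] dv[OF X(1)[OF that]]])
    also have "\<dots> \<le> a s * (M / sqrt \<gamma> * d s)"
      using dv_u[OF that] a(2)[OF that] by (rule mult_left_mono)
    finally have "\<bar>\<alpha> * G s\<bar> \<le> \<alpha> * (a s * (M / sqrt \<gamma> * d s))"
      using mult_left_mono[of "\<bar>G s\<bar>" _ \<alpha>] pos by (simp only: abs_mult abs_of_pos)
    also have "\<dots> = (\<alpha> * (M / sqrt \<gamma>)) * (a s * d s)" by simp
    also have "\<dots> \<le> 1 / 2 * (a s * d s)"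
    proof (rule mult_right_mono)
      show "\<alpha> * (M / sqrt \<gamma>) \<le> 1 / 2" using \<alpha>(1) pos by (simp add: field_simps)
      show "0 \<le> a s * d s" using a d that by simp
    qed
    also have "\<dots> \<le> E s / 2"
      using sum_squares_bound[of "a s" "d s"] E_eq[OF that] by simp
    finally show ?thesis .
  qed
  define E' where "E' = (\<lambda>s. B (utt s) (ut s) + \<gamma> * D (u s) (ut s))"
  define G' where "G' = (\<lambda>s. B (utt s) (dv (u s)) + B (ut s) (dv (ut s)))"
  have der: "(L has_real_derivative E' s + \<alpha> * G' s) (at s within {0..})" if "s \<ge> 0" for s
  proof -
    have "((\<lambda>s. B (ut s) (ut s)) has_real_derivative B (utt s) (ut s) + B (ut s) (utt s)) (at s within {0..})"
      by (rule product_rule) (use that X ut in auto)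
    moreover have "((\<lambda>s. D (u s) (u s)) has_real_derivative D (ut s) (u s) + D (u s) (ut s)) (at s within {0..})"
      by (rule D.product_rule) (use that X uD in auto)
    moreover have "(G has_real_derivative G' s) (at s within {0..})"
      unfolding G_def G'_def
    proof (rule product_rule)
      show "curve_derivative {0..} (\<lambda>s. dv (u s)) s (dv (ut s))"
        unfolding dv_def
        by (rule curve_derivative_orthogonal_part[OF Z(1,2) p]) (use that X u in auto)
    qed (use that X ut dv in auto)
    ultimately have "((\<lambda>s. 1 / 2 * B (ut s) (ut s) + \<gamma> / 2 * D (u s) (u s) + \<alpha> * G s) has_real_derivative
        1 / 2 * (B (utt s) (ut s) + B (ut s) (utt s)) + \<gamma> / 2 * (D (ut s) (u s) + D (u s) (ut s)) + \<alpha> * G' s)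
        (at s within {0..})"
      by (intro DERIV_add DERIV_cmult)
    moreover have "1 / 2 * (B (utt s) (ut s) + B (ut s) (utt s)) + \<gamma> / 2 * (D (ut s) (u s) + D (u s) (ut s)) = E' s"
      using sym[OF X(2,3)[OF that]] D.sym[OF X(1,2)[OF that]] by (simp add: E'_def)
    ultimately show ?thesis by (simp add: L_def E[abs_def])
  qed
  have E'_le: "E' s \<le> - c * (a s)\<^sup>2" if "s \<ge> 0" for s
    using eqn[OF that X(2)[OF that]] K_coercive[OF X(2)[OF that]] a(1)[OF that] by (simp add: E'_def)
  have G'_le: "G' s \<le> chi / 2 * (a s)\<^sup>2 - (d s)\<^sup>2 / 2" if "s \<ge> 0" for s
  proof -
    note mem = X[OF that] dv[OF X(1)[OF that]] dv[OF X(2)[OF that]]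
    have pu: "p (u s) \<in> Z" "p (u s) \<in> X" using p(1) Z(2) mem by auto
    \<comment> \<open>Subtracting a divergence-free field does not change the divergence.\<close>
    have "D (u s) (dv (u s)) = D (u s) (u s)"
      unfolding dv_def using D.diff_right[OF mem(1) pu(2) mem(1)] D.B_null[OF mem(1) pu(2)] Z(3)[OF pu(1)] by simp
    with eqn[OF that mem(4)] d(1)[OF that]
    have "B (utt s) (dv (u s)) = - K (ut s) (dv (u s)) - (d s)\<^sup>2" by simp
    moreover have "- K (ut s) (dv (u s)) \<le> (d s)\<^sup>2 / 2 + (chi - 2) / 2 * (a s)\<^sup>2"
    proof -
      let ?e = "M * k / sqrt \<gamma>"
      have "- K (ut s) (dv (u s)) \<le> k * (a s * N (dv (u s)))"
        using K_bounded[OF mem(2,4)] by (simp add: a_def)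
      also have "\<dots> \<le> k * (a s * (M / sqrt \<gamma> * d s))"
        using dv_u[OF that] a(2)[OF that] pos by (intro mult_left_mono) auto
      also have "\<dots> = (?e * a s) * d s" by simp
      also have "\<dots> \<le> ((?e * a s)\<^sup>2 + (d s)\<^sup>2) / 2"
        using sum_squares_bound[of "?e * a s" "d s"] by (simp add: mult_ac)
      also have "(?e * a s)\<^sup>2 = (chi - 2) * (a s)\<^sup>2"
        using pos by (simp add: chi_eq power_mult_distrib power_divide)
      finally show ?thesis by simp
    qed
    moreover have "B (ut s) (dv (ut s)) \<le> (a s)\<^sup>2"
    proof -
      have "B (ut s) (dv (ut s)) \<le> N (ut s) * N (dv (ut s))"
        using Cauchy_Schwarz[OF mem(2,5)] by simp
      also have "\<dots> \<le> N (ut s) * N (ut s)"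
        using dv_le[OF mem(2)] N_nonneg[OF mem(2)] by (rule mult_left_mono)
      finally show ?thesis by (simp add: a_def power2_eq_square)
    qed
    ultimately show ?thesis
      by (simp add: G'_def left_diff_distrib diff_divide_distrib)
  qed
  have L'_le: "E' s + \<alpha> * G' s \<le> - (2 * \<alpha> / 3) * L s" if "s \<ge> 0" for s
  proof -
    have "chi \<ge> 2" using pos chi_eq by simp
    then have c: "\<alpha> * (1 + chi) / 2 \<le> c" using \<alpha>(2) by (simp add: field_simps)
    have "E' s + \<alpha> * G' s \<le> - c * (a s)\<^sup>2 + \<alpha> * (chi / 2 * (a s)\<^sup>2 - (d s)\<^sup>2 / 2)"
      by (rule add_mono[OF E'_le[OF that] mult_left_mono[OF G'_le[OF that]]]) (use pos in simp)
    also have "\<dots> \<le> - (\<alpha> * (1 + chi) / 2) * (a s)\<^sup>2 + \<alpha> * (chi / 2 * (a s)\<^sup>2 - (d s)\<^sup>2 / 2)"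
      using mult_right_mono[OF c, of "(a s)\<^sup>2"] by (intro add_mono) auto
    also have "\<dots> = - \<alpha> * E s" by (simp add: E_eq[OF that] field_simps)
    also have "\<dots> \<le> - (2 * \<alpha> / 3) * L s"
    proof -
      have "L s \<le> 3 / 2 * E s" using G_le[OF that] by (simp add: L_def)
      from mult_left_mono[OF this, of "2 * \<alpha> / 3"] pos show ?thesis by (simp add: mult_ac)
    qed
    finally show ?thesis .
  qed
  have "L t \<le> L 0 * exp (- (2 * \<alpha> / 3) * t)"
    using der L'_le t by (rule exponential_decay_if_derivative_le)
  also have "\<dots> \<le> (3 / 2 * E 0) * exp (- (2 * \<alpha> / 3) * t)"
    using G_le[of 0] by (intro mult_right_mono) (auto simp: L_def)
  finally have "L t \<le> (3 / 2 * E 0) * exp (- (2 * \<alpha> / 3) * t)" .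
  moreover have "E t \<le> 2 * L t" using G_le[OF t] by (simp add: L_def)
  ultimately show ?thesis by simp
qed

end

section \<open>Weighted inner products on L2\<close>

lemma semi_inner_space_subset:
  assumes "semi_inner_space X B" "function_subspace Y" "Y \<subseteq> X"
  shows "semi_inner_space Y B"
proof -
  interpret semi_inner_space X B by (rule assms(1))
  show ?thesis
    using assms(2) lincomb sym nonneg subsetD[OF assms(3)] by unfold_locales auto
qed

lemma L2_D:
  assumes "u \<in> L2 \<Omega>"
  shows "u \<in> borel_measurable (lebesgue_on \<Omega>)" "integrable (lebesgue_on \<Omega>) (\<lambda>x. (norm (u x))\<^sup>2)"
  using assms by (auto simp: L2_def)

lemma L2_norm: "u \<in> L2 \<Omega> \<Longrightarrow> (\<lambda>x. norm (u x)) \<in> L2 \<Omega>"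
  by (auto simp: L2_def)

lemma function_subspace_L2: "function_subspace (L2 \<Omega> :: (real^2 \<Rightarrow> 'b::euclidean_space) set)"
  unfolding function_subspace_def
proof (intro conjI ballI allI)
  have "(\<lambda>x. 0) \<in> (L2 \<Omega> :: (real^2 \<Rightarrow> 'b) set)" by (simp add: L2_def)
  then show "(L2 \<Omega> :: (real^2 \<Rightarrow> 'b) set) \<noteq> {}" by blast
  fix u v :: "real^2 \<Rightarrow> 'b" and a b :: real
  assume u: "u \<in> L2 \<Omega>" and v: "v \<in> L2 \<Omega>"
  have meas: "(\<lambda>x. a *\<^sub>R u x + b *\<^sub>R v x) \<in> borel_measurable (lebesgue_on \<Omega>)"
    using L2_D(1)[OF u] L2_D(1)[OF v] by auto
  have "integrable (lebesgue_on \<Omega>) (\<lambda>x. (norm (a *\<^sub>R u x + b *\<^sub>R v x))\<^sup>2)"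
  proof (rule Bochner_Integration.integrable_bound)
    show "integrable (lebesgue_on \<Omega>) (\<lambda>x. 2 * a\<^sup>2 * (norm (u x))\<^sup>2 + 2 * b\<^sup>2 * (norm (v x))\<^sup>2)"
      using L2_D(2)[OF u] L2_D(2)[OF v] by auto
    show "(\<lambda>x. (norm (a *\<^sub>R u x + b *\<^sub>R v x))\<^sup>2) \<in> borel_measurable (lebesgue_on \<Omega>)"
      using meas by measurable
    show "AE x in lebesgue_on \<Omega>. norm ((norm (a *\<^sub>R u x + b *\<^sub>R v x))\<^sup>2)
        \<le> norm (2 * a\<^sup>2 * (norm (u x))\<^sup>2 + 2 * b\<^sup>2 * (norm (v x))\<^sup>2)"
    proof (intro always_eventually allI)
      fix x
      have "(norm (a *\<^sub>R u x + b *\<^sub>R v x))\<^sup>2 \<le> (\<bar>a\<bar> * norm (u x) + \<bar>b\<bar> * norm (v x))\<^sup>2"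
        by (intro power_mono norm_triangle_le) auto
      also have "\<dots> \<le> 2 * (\<bar>a\<bar> * norm (u x))\<^sup>2 + 2 * (\<bar>b\<bar> * norm (v x))\<^sup>2"
        using sum_squares_bound[of "\<bar>a\<bar> * norm (u x)" "\<bar>b\<bar> * norm (v x)"]
        by (simp add: power2_sum)
      finally show "norm ((norm (a *\<^sub>R u x + b *\<^sub>R v x))\<^sup>2)
          \<le> norm (2 * a\<^sup>2 * (norm (u x))\<^sup>2 + 2 * b\<^sup>2 * (norm (v x))\<^sup>2)"
        by (simp add: power_mult_distrib)
    qed
  qed
  with meas show "(\<lambda>x. a *\<^sub>R u x + b *\<^sub>R v x) \<in> L2 \<Omega>" by (simp add: L2_def)
qed

lemma integrable_weighted_inner:
  fixes u v :: "real^2 \<Rightarrow> 'b::euclidean_space"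
  assumes u: "u \<in> L2 \<Omega>" and v: "v \<in> L2 \<Omega>"
    and w: "w \<in> borel_measurable (lebesgue_on \<Omega>)" "AE x in lebesgue_on \<Omega>. \<bar>w x\<bar> \<le> c"
  shows "integrable (lebesgue_on \<Omega>) (\<lambda>x. (w x *\<^sub>R u x) \<bullet> v x)"
proof (rule Bochner_Integration.integrable_bound)
  show "integrable (lebesgue_on \<Omega>) (\<lambda>x. c * ((norm (u x))\<^sup>2 + (norm (v x))\<^sup>2))"
    using L2_D(2)[OF u] L2_D(2)[OF v] by auto
  show "(\<lambda>x. (w x *\<^sub>R u x) \<bullet> v x) \<in> borel_measurable (lebesgue_on \<Omega>)"
    using L2_D(1)[OF u] L2_D(1)[OF v] w(1) by auto
  show "AE x in lebesgue_on \<Omega>. norm ((w x *\<^sub>R u x) \<bullet> v x) \<le> norm (c * ((norm (u x))\<^sup>2 + (norm (v x))\<^sup>2))"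
    using w(2)
  proof eventually_elim
    case (elim x)
    have "\<bar>u x \<bullet> v x\<bar> \<le> norm (u x) * norm (v x)" by (rule Cauchy_Schwarz_ineq2)
    also have "\<dots> \<le> (norm (u x))\<^sup>2 + (norm (v x))\<^sup>2"
      using sum_squares_bound[of "norm (u x)" "norm (v x)"] by (simp add: field_simps) (smt (verit) mult_nonneg_nonneg norm_ge_zero)
    finally have "\<bar>w x\<bar> * \<bar>u x \<bullet> v x\<bar> \<le> \<bar>c\<bar> * ((norm (u x))\<^sup>2 + (norm (v x))\<^sup>2)"
      using elim by (intro mult_mono) auto
    then show ?case by (simp add: abs_mult)
  qed
qed

lemma semi_inner_space_weighted:
  assumes w: "w \<in> borel_measurable (lebesgue_on \<Omega>)" "AE x in lebesgue_on \<Omega>. 0 \<le> w x \<and> w x \<le> c"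
  shows "semi_inner_space (L2 \<Omega> :: (real^2 \<Rightarrow> 'b::euclidean_space) set) (\<lambda>u v. l2_inner \<Omega> (\<lambda>x. w x *\<^sub>R u x) v)"
proof
  have w': "AE x in lebesgue_on \<Omega>. \<bar>w x\<bar> \<le> c"
    using w(2) by eventually_elim auto
  show "function_subspace (L2 \<Omega> :: (real^2 \<Rightarrow> 'b) set)" by (rule function_subspace_L2)
  fix u v z :: "real^2 \<Rightarrow> 'b" and a b :: real
  assume u: "u \<in> L2 \<Omega>"
  have "AE x in lebesgue_on \<Omega>. 0 \<le> (w x *\<^sub>R u x) \<bullet> u x"
    using w(2) by eventually_elim simp
  then show "0 \<le> l2_inner \<Omega> (\<lambda>x. w x *\<^sub>R u x) u"
    unfolding l2_inner_def by (rule integral_nonneg_AE)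
  assume v: "v \<in> L2 \<Omega>"
  show "l2_inner \<Omega> (\<lambda>x. w x *\<^sub>R u x) v = l2_inner \<Omega> (\<lambda>x. w x *\<^sub>R v x) u"
    unfolding l2_inner_def by (simp add: inner_commute)
  assume z: "z \<in> L2 \<Omega>"
  have eq: "(\<lambda>x. (w x *\<^sub>R (a *\<^sub>R u x + b *\<^sub>R v x)) \<bullet> z x)
      = (\<lambda>x. a * ((w x *\<^sub>R u x) \<bullet> z x) + b * ((w x *\<^sub>R v x) \<bullet> z x))"
    by (simp add: fun_eq_iff inner_add_left algebra_simps)
  show "l2_inner \<Omega> (\<lambda>x. w x *\<^sub>R (a *\<^sub>R u x + b *\<^sub>R v x)) z
      = a * l2_inner \<Omega> (\<lambda>x. w x *\<^sub>R u x) z + b * l2_inner \<Omega> (\<lambda>x. w x *\<^sub>R v x) z"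
    unfolding l2_inner_def eq
    using integrable_weighted_inner[OF u z w(1) w'] integrable_weighted_inner[OF v z w(1) w'] by simp
qed

lemma semi_inner_space_L2:
  "semi_inner_space (L2 \<Omega> :: (real^2 \<Rightarrow> 'b::euclidean_space) set) (l2_inner \<Omega>)"
  using semi_inner_space_weighted[of "\<lambda>x. 1" \<Omega> 1] by simp

lemma l2_inner_cong_AE:
  assumes "u \<in> L2 \<Omega>" "u' \<in> L2 \<Omega>" "v \<in> L2 \<Omega>" "AE x in lebesgue_on \<Omega>. u x = u' x"
  shows "l2_inner \<Omega> u v = l2_inner \<Omega> u' v"
  unfolding l2_inner_def
proof (rule integral_cong_AE)
  show "(\<lambda>x. u x \<bullet> v x) \<in> borel_measurable (lebesgue_on \<Omega>)"
    "(\<lambda>x. u' x \<bullet> v x) \<in> borel_measurable (lebesgue_on \<Omega>)"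
    using assms(1-3)[THEN L2_D(1)] by auto
  show "AE x in lebesgue_on \<Omega>. u x \<bullet> v x = u' x \<bullet> v x"
    using assms(4) by eventually_elim simp
qed

lemma weighted_norm_eq:
  "weighted_norm \<Omega> w u = sqrt (l2_inner \<Omega> (\<lambda>x. w x *\<^sub>R u x) u)"
  by (simp add: weighted_norm_def l2_inner_def power2_norm_eq_inner)

text \<open>Cauchy-Schwarz for the scalar fields \<open>\<bar>u\<bar>\<close> and \<open>\<bar>v\<bar>\<close> rather than for \<open>u\<close> and \<open>v\<close>, so that only
  the size of \<open>F\<close> matters; this covers the rotation and the damping term alike.\<close>

lemma weighted_form_bound:
  fixes u v F :: "real^2 \<Rightarrow> 'b::euclidean_space"
  assumes w: "w \<in> borel_measurable (lebesgue_on \<Omega>)" "AE x in lebesgue_on \<Omega>. 0 \<le> w x \<and> w x \<le> c"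
    and u: "u \<in> L2 \<Omega>" and v: "v \<in> L2 \<Omega>"
    and F: "AE x in lebesgue_on \<Omega>. norm (F x) \<le> m * (w x * norm (u x))" and m: "m \<ge> 0"
  shows "\<bar>l2_inner \<Omega> F v\<bar> \<le> m * (sqrt (l2_inner \<Omega> (\<lambda>x. w x *\<^sub>R u x) u) * sqrt (l2_inner \<Omega> (\<lambda>x. w x *\<^sub>R v x) v))"
proof -
  interpret S: semi_inner_space "L2 \<Omega> :: scalar_field set" "\<lambda>f g. l2_inner \<Omega> (\<lambda>x. w x *\<^sub>R f x) g"
    by (rule semi_inner_space_weighted[OF w])
  have w': "AE x in lebesgue_on \<Omega>. \<bar>w x\<bar> \<le> c" using w(2) by eventually_elim auto
  have norm_sq: "l2_inner \<Omega> (\<lambda>x. w x *\<^sub>R norm (f x)) (\<lambda>x. norm (f x)) = l2_inner \<Omega> (\<lambda>x. w x *\<^sub>R f x) f"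
    for f :: "real^2 \<Rightarrow> 'b"
    by (simp add: l2_inner_def power2_eq_square[symmetric] power2_norm_eq_inner mult.assoc)
  let ?b = "\<lambda>x. m * ((w x *\<^sub>R norm (u x)) \<bullet> norm (v x))"
  have "\<bar>l2_inner \<Omega> F v\<bar> \<le> (\<integral>x. \<bar>F x \<bullet> v x\<bar> \<partial>lebesgue_on \<Omega>)"
    unfolding l2_inner_def by (rule integral_abs_bound)
  also have "\<dots> \<le> (\<integral>x. ?b x \<partial>lebesgue_on \<Omega>)"
  proof (rule integral_mono_AE')
    show "integrable (lebesgue_on \<Omega>) ?b"
      using integrable_weighted_inner[OF L2_norm[OF u] L2_norm[OF v] w(1) w'] by (rule integrable_mult_right)
    show "AE x in lebesgue_on \<Omega>. 0 \<le> ?b x"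
      using w(2) by eventually_elim (use m in simp)
    show "AE x in lebesgue_on \<Omega>. \<bar>F x \<bullet> v x\<bar> \<le> ?b x"
      using F
    proof eventually_elim
      case (elim x)
      have "\<bar>F x \<bullet> v x\<bar> \<le> norm (F x) * norm (v x)" by (rule Cauchy_Schwarz_ineq2)
      also have "\<dots> \<le> m * (w x * norm (u x)) * norm (v x)" using elim by (rule mult_right_mono) simp
      finally show ?case by simp
    qed
  qed
  also have "\<dots> = m * l2_inner \<Omega> (\<lambda>x. w x *\<^sub>R norm (u x)) (\<lambda>x. norm (v x))"
    by (simp add: l2_inner_def)
  also have "\<dots> \<le> m * (sqrt (l2_inner \<Omega> (\<lambda>x. w x *\<^sub>R u x) u) * sqrt (l2_inner \<Omega> (\<lambda>x. w x *\<^sub>R v x) v))"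
    using S.Cauchy_Schwarz[OF L2_norm[OF u] L2_norm[OF v]] m
    unfolding S.N_def norm_sq by (intro mult_left_mono) auto
  finally show ?thesis .
qed

lemma l2_inner_self_mono:
  fixes u :: "real^2 \<Rightarrow> 'b::euclidean_space"
  assumes "u \<in> L2 \<Omega>" "v \<in> borel_measurable (lebesgue_on \<Omega>)" "AE x in lebesgue_on \<Omega>. \<bar>v x\<bar> \<le> c"
    and "AE x in lebesgue_on \<Omega>. 0 \<le> w x \<and> w x \<le> v x"
  shows "l2_inner \<Omega> (\<lambda>x. w x *\<^sub>R u x) u \<le> l2_inner \<Omega> (\<lambda>x. v x *\<^sub>R u x) u"
  unfolding l2_inner_def
proof (rule integral_mono_AE')
  show "integrable (lebesgue_on \<Omega>) (\<lambda>x. (v x *\<^sub>R u x) \<bullet> u x)"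
    by (rule integrable_weighted_inner[OF assms(1,1,2,3)])
  show "AE x in lebesgue_on \<Omega>. (w x *\<^sub>R u x) \<bullet> u x \<le> (v x *\<^sub>R u x) \<bullet> u x"
    using assms(4) by eventually_elim (simp add: mult_right_mono)
  show "AE x in lebesgue_on \<Omega>. 0 \<le> (v x *\<^sub>R u x) \<bullet> u x"
    using assms(4) by eventually_elim simp
qed

section \<open>Linearity of the weak divergence\<close>

lemma continuous_in_L2:
  fixes g :: "real^2 \<Rightarrow> 'b::euclidean_space"
  assumes \<Omega>: "bounded_domain \<Omega>" and g: "continuous_on UNIV g"
  shows "g \<in> L2 \<Omega>"
proof -
  have "bounded (g ` closure \<Omega>)"
    using \<Omega> g by (intro compact_imp_bounded compact_continuous_image)
      (auto intro: continuous_on_subset simp: bounded_domain_def compact_closure)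
  then obtain c where c: "\<And>x. x \<in> \<Omega> \<Longrightarrow> norm (g x) \<le> c"
    unfolding bounded_iff using closure_subset by blast
  have meas: "g \<in> borel_measurable (lebesgue_on \<Omega>)"
    using g by (intro measurable_restrict_space1 measurable_completion)
      (simp add: borel_measurable_continuous_onI)
  have "\<Omega> \<in> lmeasurable"
    using \<Omega> by (simp add: bounded_domain_def lmeasurable_open)
  then interpret finite_measure "lebesgue_on \<Omega>" by (rule finite_measure_lebesgue_on)
  have "integrable (lebesgue_on \<Omega>) (\<lambda>x. (norm (g x))\<^sup>2)"
  proof (rule integrable_const_bound)
    have "norm ((norm (g x))\<^sup>2) \<le> c\<^sup>2" if "x \<in> \<Omega>" for x
      using power_mono[OF c[OF that], of 2] by simp
    then show "AE x in lebesgue_on \<Omega>. norm ((norm (g x))\<^sup>2) \<le> c\<^sup>2"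
      by (intro AE_I2) simp
  qed (use meas in auto)
  with meas show ?thesis by (simp add: L2_def)
qed

lemma test_functions_L2:
  assumes "bounded_domain \<Omega>" "\<phi> \<in> test_functions \<Omega>"
  shows "\<phi> \<in> L2 \<Omega>" "grad \<phi> \<in> L2 \<Omega>"
proof -
  have C: "C_k 0 \<phi>" "C_k (Suc 0) \<phi>" using assms(2) unfolding test_functions_def by blast+
  show "\<phi> \<in> L2 \<Omega>" using C(1) assms(1) by (intro continuous_in_L2) auto
  have "continuous_on UNIV (\<lambda>x. \<chi> i. partial \<phi> i x)"
    using C(2) by (intro continuous_on_vec_lambda) auto
  then show "grad \<phi> \<in> L2 \<Omega>"
    using assms(1) by (intro continuous_in_L2) (auto simp: grad_def[abs_def])
qed

text \<open>The difference of two weak divergences is orthogonal to all test functions, and it is integrable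
  because \<open>\<Omega>\<close> has finite measure.\<close>

lemma weak_div_unique:
  assumes \<Omega>: "bounded_domain \<Omega>" and g: "is_weak_div \<Omega> u g" and g': "is_weak_div \<Omega> u g'"
  shows "AE x in lebesgue_on \<Omega>. g x = g' x"
proof -
  interpret L2: semi_inner_space "L2 \<Omega> :: scalar_field set" "l2_inner \<Omega>" by (rule semi_inner_space_L2)
  have gL2: "g \<in> L2 \<Omega>" "g' \<in> L2 \<Omega>" using g g' by (auto simp: is_weak_div_def)
  then have d: "(\<lambda>x. g x - g' x) \<in> L2 \<Omega>" by (rule L2.in_X(2))
  have one: "(\<lambda>x. 1) \<in> L2 \<Omega>" by (rule continuous_in_L2[OF \<Omega>]) auto
  have "integrable (lebesgue_on \<Omega>) (\<lambda>x. g x - g' x)"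
    using integrable_weighted_inner[OF d one, of "\<lambda>x. 1" 1] by simp
  moreover have "(\<integral>x. (g x - g' x) * \<phi> x \<partial>lebesgue_on \<Omega>) = 0" if \<phi>: "\<phi> \<in> test_functions \<Omega>" for \<phi>
  proof -
    have "l2_inner \<Omega> (\<lambda>x. g x - g' x) \<phi> = 0"
      using g g' \<phi> L2.diff[OF gL2 test_functions_L2(1)[OF \<Omega> \<phi>]] by (simp add: is_weak_div_def)
    then show ?thesis by (simp add: l2_inner_def)
  qed
  ultimately have "AE x in lebesgue_on \<Omega>. g x - g' x = 0"
    using \<Omega> by (intro AE_zero_if_orthogonal_to_test_functions) (auto simp: bounded_domain_def)
  then show ?thesis by eventually_elim simp
qed

lemma is_weak_div_lincomb:
  assumes \<Omega>: "bounded_domain \<Omega>" and u: "is_weak_div \<Omega> u g" and v: "is_weak_div \<Omega> v h"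
  shows "is_weak_div \<Omega> (\<lambda>x. a *\<^sub>R u x + b *\<^sub>R v x) (\<lambda>x. a *\<^sub>R g x + b *\<^sub>R h x)"
proof -
  interpret S: semi_inner_space "L2 \<Omega> :: scalar_field set" "l2_inner \<Omega>" by (rule semi_inner_space_L2)
  interpret V: semi_inner_space "L2 \<Omega> :: vector_field set" "l2_inner \<Omega>" by (rule semi_inner_space_L2)
  have mem: "u \<in> L2 \<Omega>" "v \<in> L2 \<Omega>" "g \<in> L2 \<Omega>" "h \<in> L2 \<Omega>" using u v by (auto simp: is_weak_div_def)
  show ?thesis
    unfolding is_weak_div_def
  proof (intro conjI ballI V.in_X(1) S.in_X(1) mem)
    fix \<phi> assume \<phi>: "\<phi> \<in> test_functions \<Omega>"
    note L2 = test_functions_L2[OF \<Omega> \<phi>]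
    show "l2_inner \<Omega> (\<lambda>x. a *\<^sub>R u x + b *\<^sub>R v x) (grad \<phi>) = - l2_inner \<Omega> (\<lambda>x. a *\<^sub>R g x + b *\<^sub>R h x) \<phi>"
      unfolding V.lincomb[OF mem(1,2) L2(2)] S.lincomb[OF mem(3,4) L2(1)]
      using u v \<phi> by (simp add: is_weak_div_def)
  qed
qed

lemma is_weak_div_wdiv:
  assumes "u \<in> Hdiv \<Omega>"
  shows "is_weak_div \<Omega> u (wdiv \<Omega> u)"
proof -
  have "\<exists>g. is_weak_div \<Omega> u g" using assms by (simp add: Hdiv_def)
  then show ?thesis unfolding wdiv_def by (rule someI_ex)
qed

lemma Hdiv_L2: "u \<in> Hdiv \<Omega> \<Longrightarrow> u \<in> L2 \<Omega>" "u \<in> Hdiv \<Omega> \<Longrightarrow> wdiv \<Omega> u \<in> L2 \<Omega>"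
  using is_weak_div_wdiv[of u \<Omega>] by (auto simp: is_weak_div_def)

lemma Hdiv_lincomb:
  assumes \<Omega>: "bounded_domain \<Omega>" and u: "u \<in> Hdiv \<Omega>" and v: "v \<in> Hdiv \<Omega>"
  shows "(\<lambda>x. a *\<^sub>R u x + b *\<^sub>R v x) \<in> Hdiv \<Omega>"
    and "AE x in lebesgue_on \<Omega>. wdiv \<Omega> (\<lambda>x. a *\<^sub>R u x + b *\<^sub>R v x) x = a *\<^sub>R wdiv \<Omega> u x + b *\<^sub>R wdiv \<Omega> v x"
proof -
  note * = is_weak_div_lincomb[OF \<Omega> is_weak_div_wdiv[OF u] is_weak_div_wdiv[OF v], of a b]
  then show mem: "(\<lambda>x. a *\<^sub>R u x + b *\<^sub>R v x) \<in> Hdiv \<Omega>" by (auto simp: Hdiv_def)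
  show "AE x in lebesgue_on \<Omega>. wdiv \<Omega> (\<lambda>x. a *\<^sub>R u x + b *\<^sub>R v x) x = a *\<^sub>R wdiv \<Omega> u x + b *\<^sub>R wdiv \<Omega> v x"
    by (rule weak_div_unique[OF \<Omega> is_weak_div_wdiv[OF mem] *])
qed

lemma function_subspace_Hdiv:
  assumes "bounded_domain \<Omega>"
  shows "function_subspace (Hdiv \<Omega>)"
proof -
  have "is_weak_div \<Omega> (\<lambda>x. 0) (\<lambda>x. 0)"
    by (simp add: is_weak_div_def l2_inner_def L2_def)
  then have "Hdiv \<Omega> \<noteq> {}" by (auto simp: Hdiv_def)
  with Hdiv_lincomb(1)[OF assms] show ?thesis by (simp add: function_subspace_def)
qed

lemma wdiv_inner_lincomb:
  assumes \<Omega>: "bounded_domain \<Omega>" and u: "u \<in> Hdiv \<Omega>" and v: "v \<in> Hdiv \<Omega>" and g: "g \<in> L2 \<Omega>"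
  shows "l2_inner \<Omega> (wdiv \<Omega> (\<lambda>x. a *\<^sub>R u x + b *\<^sub>R v x)) g
    = a * l2_inner \<Omega> (wdiv \<Omega> u) g + b * l2_inner \<Omega> (wdiv \<Omega> v) g"
proof -
  interpret S: semi_inner_space "L2 \<Omega> :: scalar_field set" "l2_inner \<Omega>" by (rule semi_inner_space_L2)
  note L2 = Hdiv_L2(2)[OF u] Hdiv_L2(2)[OF v]
  show ?thesis
    using l2_inner_cong_AE[OF Hdiv_L2(2)[OF Hdiv_lincomb(1)[OF \<Omega> u v]] S.in_X(1)[OF L2] g Hdiv_lincomb(2)[OF \<Omega> u v], of a b]
      S.lincomb[OF L2 g] by simp
qed

lemma semi_inner_space_wdiv:
  assumes \<Omega>: "bounded_domain \<Omega>"
  shows "semi_inner_space (Hdiv \<Omega>) (\<lambda>u v. l2_inner \<Omega> (wdiv \<Omega> u) (wdiv \<Omega> v))"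
proof
  show "function_subspace (Hdiv \<Omega>)" by (rule function_subspace_Hdiv[OF \<Omega>])
  interpret S: semi_inner_space "L2 \<Omega> :: scalar_field set" "l2_inner \<Omega>" by (rule semi_inner_space_L2)
  fix u v w :: vector_field and a b :: real
  assume u: "u \<in> Hdiv \<Omega>"
  show "0 \<le> l2_inner \<Omega> (wdiv \<Omega> u) (wdiv \<Omega> u)" by (rule S.nonneg[OF Hdiv_L2(2)[OF u]])
  assume v: "v \<in> Hdiv \<Omega>"
  show "l2_inner \<Omega> (wdiv \<Omega> u) (wdiv \<Omega> v) = l2_inner \<Omega> (wdiv \<Omega> v) (wdiv \<Omega> u)"
    by (rule S.sym[OF Hdiv_L2(2)[OF u] Hdiv_L2(2)[OF v]])
  assume w: "w \<in> Hdiv \<Omega>"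
  show "l2_inner \<Omega> (wdiv \<Omega> (\<lambda>x. a *\<^sub>R u x + b *\<^sub>R v x)) (wdiv \<Omega> w)
      = a * l2_inner \<Omega> (wdiv \<Omega> u) (wdiv \<Omega> w) + b * l2_inner \<Omega> (wdiv \<Omega> v) (wdiv \<Omega> w)"
    by (rule wdiv_inner_lincomb[OF \<Omega> u v Hdiv_L2(2)[OF w]])
qed

lemma function_subspace_div_free:
  assumes \<Omega>: "bounded_domain \<Omega>" and W: "function_subspace W" "W \<subseteq> Hdiv \<Omega>"
  shows "function_subspace {z \<in> W. div_free \<Omega> z}" (is "function_subspace ?Z")
proof -
  have lin: "(\<lambda>x. a *\<^sub>R y x + b *\<^sub>R z x) \<in> ?Z" if "y \<in> W" "z \<in> W"
    and ae: "AE x in lebesgue_on \<Omega>. a * wdiv \<Omega> y x + b * wdiv \<Omega> z x = 0" for y z a b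
  proof -
    have "AE x in lebesgue_on \<Omega>. wdiv \<Omega> (\<lambda>x. a *\<^sub>R y x + b *\<^sub>R z x) x = a *\<^sub>R wdiv \<Omega> y x + b *\<^sub>R wdiv \<Omega> z x"
      using that W(2) by (intro Hdiv_lincomb(2)[OF \<Omega>]) auto
    with ae have "AE x in lebesgue_on \<Omega>. wdiv \<Omega> (\<lambda>x. a *\<^sub>R y x + b *\<^sub>R z x) x = 0"
      by eventually_elim simp
    with function_subspaceD(1)[OF W(1) that(1,2)] show ?thesis by (simp add: div_free_def)
  qed
  note zero = function_subspaceD(4)[OF W(1)]
  have "?Z \<noteq> {}" using lin[OF zero zero, of 0 0] by auto
  moreover have "(\<lambda>x. a *\<^sub>R y x + b *\<^sub>R z x) \<in> ?Z" if yz: "y \<in> ?Z" "z \<in> ?Z" for y z a b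
  proof -
    have "AE x in lebesgue_on \<Omega>. wdiv \<Omega> y x = 0" "AE x in lebesgue_on \<Omega>. wdiv \<Omega> z x = 0"
      using yz by (auto simp: div_free_def)
    then have "AE x in lebesgue_on \<Omega>. a * wdiv \<Omega> y x + b * wdiv \<Omega> z x = 0"
      by eventually_elim simp
    with yz show ?thesis by (intro lin) auto
  qed
  ultimately show ?thesis unfolding function_subspace_def by blast
qed

text \<open>The normal trace is linear because \<open>wdiv\<close> is, up to null sets.\<close>

lemma function_subspace_Hdiv0:
  assumes \<Omega>: "bounded_domain \<Omega>"
  shows "function_subspace (Hdiv0 \<Omega>)"
proof -
  interpret V: semi_inner_space "L2 \<Omega> :: vector_field set" "l2_inner \<Omega>" by (rule semi_inner_space_L2)
  have lin: "(\<lambda>x. a *\<^sub>R u x + b *\<^sub>R v x) \<in> Hdiv0 \<Omega>"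
    if u: "u \<in> Hdiv \<Omega>" and v: "v \<in> Hdiv \<Omega>"
      and tr: "\<And>\<phi> G. is_weak_grad \<Omega> \<phi> G \<Longrightarrow>
        a * (l2_inner \<Omega> u G + l2_inner \<Omega> (wdiv \<Omega> u) \<phi>) + b * (l2_inner \<Omega> v G + l2_inner \<Omega> (wdiv \<Omega> v) \<phi>) = 0"
    for a b u v
  proof -
    have "l2_inner \<Omega> (\<lambda>x. a *\<^sub>R u x + b *\<^sub>R v x) G + l2_inner \<Omega> (wdiv \<Omega> (\<lambda>x. a *\<^sub>R u x + b *\<^sub>R v x)) \<phi> = 0"
      if "is_weak_grad \<Omega> \<phi> G" for \<phi> G
    proof -
      have L2: "\<phi> \<in> L2 \<Omega>" "G \<in> L2 \<Omega>" using that by (auto simp: is_weak_grad_def)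
      show ?thesis
        unfolding wdiv_inner_lincomb[OF \<Omega> u v L2(1)] V.lincomb[OF Hdiv_L2(1)[OF u] Hdiv_L2(1)[OF v] L2(2)]
        using tr[OF that] by (simp add: algebra_simps)
    qed
    with Hdiv_lincomb(1)[OF \<Omega> u v] show ?thesis by (simp add: Hdiv0_def zero_normal_trace_def)
  qed
  note zero = function_subspaceD(4)[OF function_subspace_Hdiv[OF \<Omega>]]
  have "Hdiv0 \<Omega> \<noteq> {}" using lin[OF zero zero, of 0 0] by auto
  moreover have "(\<lambda>x. a *\<^sub>R u x + b *\<^sub>R v x) \<in> Hdiv0 \<Omega>" if "u \<in> Hdiv0 \<Omega>" "v \<in> Hdiv0 \<Omega>" for u v a b
    using that by (intro lin) (auto simp: Hdiv0_def zero_normal_trace_def)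
  ultimately show ?thesis by (simp add: function_subspace_def)
qed

section \<open>Mixed finite element spaces\<close>

lemma function_subspace_polys: "function_subspace (polys k)"
  unfolding function_subspace_def
proof (intro conjI ballI allI)
  have "(\<lambda>x. 0) \<in> polys k" unfolding polys_def by (auto intro!: exI[of _ "\<lambda>i j. 0"])
  then show "polys k \<noteq> {}" by blast
  fix p q :: scalar_field and a b :: real assume "p \<in> polys k" "q \<in> polys k"
  then obtain c d where
    c: "\<And>x. p x = (\<Sum>i\<le>k. \<Sum>j\<le>k - i. c i j * (x $ 1) ^ i * (x $ 2) ^ j)" and
    d: "\<And>x. q x = (\<Sum>i\<le>k. \<Sum>j\<le>k - i. d i j * (x $ 1) ^ i * (x $ 2) ^ j)"
    unfolding polys_def by blast
  have "a *\<^sub>R p x + b *\<^sub>R q x = (\<Sum>i\<le>k. \<Sum>j\<le>k - i. (a * c i j + b * d i j) * (x $ 1) ^ i * (x $ 2) ^ j)" for x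
    by (simp add: c d sum_distrib_left sum.distrib algebra_simps)
  then show "(\<lambda>x. a *\<^sub>R p x + b *\<^sub>R q x) \<in> polys k"
    unfolding polys_def by (intro CollectI exI[of _ "\<lambda>i j. a * c i j + b * d i j"]) simp
qed

lemma function_subspace_vpolys: "function_subspace (vpolys k)"
proof -
  note polys = function_subspaceD[OF function_subspace_polys[of k]]
  have "(\<lambda>x. 0) \<in> vpolys k" using polys(4) by (simp add: vpolys_def)
  moreover have "(\<lambda>x. a *\<^sub>R p x + b *\<^sub>R q x) \<in> vpolys k" if "p \<in> vpolys k" "q \<in> vpolys k" for a b p q
    using that polys(1)[of "\<lambda>x. p x $ i" "\<lambda>x. q x $ i" a b for i] by (simp add: vpolys_def)
  ultimately show ?thesis unfolding function_subspace_def by blast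
qed

lemma RT_localI: "p \<in> vpolys k \<Longrightarrow> q \<in> polys k \<Longrightarrow> (\<lambda>x. p x + q x *\<^sub>R x) \<in> RT_local k"
  unfolding RT_local_def by blast

lemma function_subspace_RT_local: "function_subspace (RT_local k)"
  unfolding function_subspace_def
proof (intro conjI ballI allI)
  note v = function_subspaceD[OF function_subspace_vpolys[of k]]
  note s = function_subspaceD[OF function_subspace_polys[of k]]
  show "RT_local k \<noteq> {}" using RT_localI[OF v(4) s(4)] by blast
  fix u u' a b assume "u \<in> RT_local k" "u' \<in> RT_local k"
  then obtain p q p' q' where u: "u = (\<lambda>x. p x + q x *\<^sub>R x)" "p \<in> vpolys k" "q \<in> polys k"
    and u': "u' = (\<lambda>x. p' x + q' x *\<^sub>R x)" "p' \<in> vpolys k" "q' \<in> polys k"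
    unfolding RT_local_def by blast
  have "(\<lambda>x. a *\<^sub>R u x + b *\<^sub>R u' x)
      = (\<lambda>x. (a *\<^sub>R p x + b *\<^sub>R p' x) + (a *\<^sub>R q x + b *\<^sub>R q' x) *\<^sub>R x)"
    by (simp add: u u' fun_eq_iff algebra_simps)
  with RT_localI[OF v(1)[OF u(2) u'(2)] s(1)[OF u(3) u'(3)], of a b a b]
  show "(\<lambda>x. a *\<^sub>R u x + b *\<^sub>R u' x) \<in> RT_local k" by simp
qed

text \<open>The edge condition is linear in the field: the polynomials \<open>q\<close> witnessing it can be combined.\<close>

lemma function_subspace_BDFM_local: "function_subspace (BDFM_local k K)"
  unfolding function_subspace_def
proof (intro conjI ballI allI)
  note v = function_subspaceD[OF function_subspace_vpolys[of k]]
  have "(\<lambda>x. 0) \<in> BDFM_local k K" using v(4) by (auto simp: BDFM_local_def intro!: exI[of _ 0])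
  then show "BDFM_local k K \<noteq> {}" by blast
  fix u u' :: vector_field and a b :: real assume u: "u \<in> BDFM_local k K" and u': "u' \<in> BDFM_local k K"
  have "\<exists>q :: real poly. degree q \<le> k - 1 \<and> (\<forall>s\<in>{0..1}.
      (a *\<^sub>R u ((1 - s) *\<^sub>R y + s *\<^sub>R z) + b *\<^sub>R u' ((1 - s) *\<^sub>R y + s *\<^sub>R z)) \<bullet> perp (z - y) = poly q s)"
    if "y extreme_point_of K" "z extreme_point_of K" "y \<noteq> z" for y z
  proof -
    obtain q where q: "degree q \<le> k - 1" "\<And>s. s \<in> {0..1} \<Longrightarrow> u ((1 - s) *\<^sub>R y + s *\<^sub>R z) \<bullet> perp (z - y) = poly q s"
      using u \<open>y extreme_point_of K\<close> \<open>z extreme_point_of K\<close> \<open>y \<noteq> z\<close> unfolding BDFM_local_def by blast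
    obtain q' where q': "degree q' \<le> k - 1" "\<And>s. s \<in> {0..1} \<Longrightarrow> u' ((1 - s) *\<^sub>R y + s *\<^sub>R z) \<bullet> perp (z - y) = poly q' s"
      using u' \<open>y extreme_point_of K\<close> \<open>z extreme_point_of K\<close> \<open>y \<noteq> z\<close> unfolding BDFM_local_def by blast
    have "degree (smult a q + smult b q') \<le> k - 1"
      using q(1) q'(1) by (intro degree_add_le) (meson degree_smult_le order_trans)+
    with q(2) q'(2) show ?thesis
      by (intro exI[of _ "smult a q + smult b q'"]) (simp add: inner_add_left)
  qed
  moreover have "(\<lambda>x. a *\<^sub>R u x + b *\<^sub>R u' x) \<in> vpolys k"
    using u u' v(1) by (simp add: BDFM_local_def)
  ultimately show "(\<lambda>x. a *\<^sub>R u x + b *\<^sub>R u' x) \<in> BDFM_local k K"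
    by (simp add: BDFM_local_def)
qed

lemma BDM_local_subset_RT_local: "BDM_local k \<subseteq> RT_local k"
proof
  fix p assume "p \<in> BDM_local k"
  then have "p \<in> vpolys k" by (simp add: BDM_local_def)
  from RT_localI[OF this function_subspaceD(4)[OF function_subspace_polys]]
  show "p \<in> RT_local k" by simp
qed

lemma function_subspace_fe_space:
  assumes \<Omega>: "bounded_domain \<Omega>" and P: "\<And>K. function_subspace (P K)"
  shows "function_subspace (fe_space \<Omega> \<T> P)"
  unfolding function_subspace_def
proof (intro conjI ballI allI)
  note H = function_subspaceD[OF function_subspace_Hdiv0[OF \<Omega>]]
  have "(\<lambda>x. 0) \<in> fe_space \<Omega> \<T> P"
    using H(4) function_subspaceD(4)[OF P] by (auto simp: fe_space_def intro!: bexI[of _ "\<lambda>x. 0"])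
  then show "fe_space \<Omega> \<T> P \<noteq> {}" by blast
  fix u v :: vector_field and a b :: real assume u: "u \<in> fe_space \<Omega> \<T> P" and v: "v \<in> fe_space \<Omega> \<T> P"
  have "\<exists>p\<in>P K. AE x in lebesgue_on \<Omega>. x \<in> K \<longrightarrow> a *\<^sub>R u x + b *\<^sub>R v x = p x" if K: "K \<in> \<T>" for K
  proof -
    from u v K obtain p q where pq: "p \<in> P K" "q \<in> P K" and
      p: "AE x in lebesgue_on \<Omega>. x \<in> K \<longrightarrow> u x = p x" and q: "AE x in lebesgue_on \<Omega>. x \<in> K \<longrightarrow> v x = q x"
      unfolding fe_space_def by blast
    from p q have "AE x in lebesgue_on \<Omega>. x \<in> K \<longrightarrow> a *\<^sub>R u x + b *\<^sub>R v x = a *\<^sub>R p x + b *\<^sub>R q x"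
      by eventually_elim simp
    with function_subspaceD(1)[OF P pq] show ?thesis
      by (intro bexI[of _ "\<lambda>x. a *\<^sub>R p x + b *\<^sub>R q x"])
  qed
  with u v H(1) show "(\<lambda>x. a *\<^sub>R u x + b *\<^sub>R v x) \<in> fe_space \<Omega> \<T> P" by (simp add: fe_space_def)
qed

text \<open>All three families of local spaces consist of Raviart-Thomas fields, so one parametrisation by
  coefficient arrays serves them all. The last index distinguishes the two components of the vector
  polynomial (0 and 1) from the scalar polynomial that multiplies \<open>x\<close> (2).\<close>

definition rt_field :: "nat \<Rightarrow> (nat \<Rightarrow> nat \<Rightarrow> nat \<Rightarrow> real) \<Rightarrow> vector_field" where
  "rt_field k c x = (\<Sum>i\<le>k. \<Sum>j\<le>k - i. ((x $ 1) ^ i * (x $ 2) ^ j) *\<^sub>R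
     (c i j 0 *\<^sub>R axis 1 1 + c i j 1 *\<^sub>R axis 2 1 + c i j 2 *\<^sub>R x))"

lemma rt_field_lincomb:
  "rt_field k (\<lambda>i j l. a * c i j l + b * d i j l) x = a *\<^sub>R rt_field k c x + b *\<^sub>R rt_field k d x"
  by (simp add: rt_field_def scaleR_sum_right sum.distrib[symmetric] algebra_simps)

lemma RT_local_rt_field:
  assumes "p \<in> RT_local k" shows "\<exists>c. p = rt_field k c"
proof -
  from assms obtain r q where p: "p = (\<lambda>x. r x + q x *\<^sub>R x)" and r: "r \<in> vpolys k" and q: "q \<in> polys k"
    unfolding RT_local_def by blast
  have "\<forall>l. \<exists>c. \<forall>x. r x $ l = (\<Sum>i\<le>k. \<Sum>j\<le>k - i. c i j * (x $ 1) ^ i * (x $ 2) ^ j)"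
    using r unfolding vpolys_def polys_def by blast
  from choice[OF this] obtain c where
    c: "\<And>l x. r x $ l = (\<Sum>i\<le>k. \<Sum>j\<le>k - i. c l i j * (x $ 1) ^ i * (x $ 2) ^ j)"
    by blast
  obtain d where d: "\<And>x. q x = (\<Sum>i\<le>k. \<Sum>j\<le>k - i. d i j * (x $ 1) ^ i * (x $ 2) ^ j)"
    using q unfolding polys_def by blast
  define e where "e = (\<lambda>i j (l::nat). if l = 0 then c 1 i j else if l = 1 then c 2 i j else d i j :: real)"
  have "p x = rt_field k e x" for x
  proof -
    have r_eq: "r x = r x $ 1 *\<^sub>R axis 1 1 + r x $ 2 *\<^sub>R axis 2 1"
      by (simp add: vec_eq_iff forall_2 axis_def)
    show ?thesis
      unfolding p by (subst r_eq)
        (simp add: c d rt_field_def e_def scaleR_sum_left scaleR_add_right sum.distrib[symmetric] mult_ac)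
  qed
  then show ?thesis by blast
qed

text \<open>Coefficients are chosen separately on each triangle and determine the field almost everywhere because
  the finitely many triangles cover \<open>\<Omega>\<close>.\<close>

lemma mixed_fe_space_coefficients:
  assumes \<Omega>: "bounded_domain \<Omega>" and Vh: "mixed_fe_space \<Omega> Vh"
  obtains J :: "((real^2) set \<times> nat \<times> nat \<times> nat) set"
    and R :: "vector_field \<Rightarrow> ((real^2) set \<times> nat \<times> nat \<times> nat \<Rightarrow> real) \<Rightarrow> bool"
  where "finite J" "function_subspace Vh" "Vh \<subseteq> Hdiv0 \<Omega>"
    "\<And>u v c d a b. R u c \<Longrightarrow> R v d \<Longrightarrow> R (\<lambda>x. a *\<^sub>R u x + b *\<^sub>R v x) (\<lambda>j. a * c j + b * d j)"
    "\<And>u. u \<in> Vh \<Longrightarrow> \<exists>c. R u c"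
    "\<And>u c. u \<in> Vh \<Longrightarrow> R u c \<Longrightarrow> (\<forall>j\<in>J. c j = 0) \<Longrightarrow> (AE x in lebesgue_on \<Omega>. u x = 0)"
proof -
  from Vh obtain \<T> k where mesh: "mesh \<Omega> \<T>" and cases:
    "Vh = fe_space \<Omega> \<T> (\<lambda>K. RT_local k) \<or> (k \<ge> 1 \<and> Vh = fe_space \<Omega> \<T> (\<lambda>K. BDM_local k)) \<or>
      (k \<ge> 1 \<and> Vh = fe_space \<Omega> \<T> (\<lambda>K. BDFM_local k K))"
    unfolding mixed_fe_space_def by blast
  then obtain P where P: "Vh = fe_space \<Omega> \<T> P" "\<And>K. function_subspace (P K)" "\<And>K. P K \<subseteq> RT_local k"
  proof (elim disjE conjE)
    assume "Vh = fe_space \<Omega> \<T> (\<lambda>K. RT_local k)"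
    then show thesis by (rule that) (auto intro: function_subspace_RT_local)
  next
    assume "Vh = fe_space \<Omega> \<T> (\<lambda>K. BDM_local k)"
    then show thesis
      by (rule that) (use BDM_local_subset_RT_local function_subspace_vpolys BDM_local_def in auto)
  next
    assume "Vh = fe_space \<Omega> \<T> (\<lambda>K. BDFM_local k K)"
    then show thesis
      by (rule that) (use BDM_local_subset_RT_local function_subspace_BDFM_local in
          \<open>auto simp: BDFM_local_def BDM_local_def\<close>)
  qed
  have fin: "finite \<T>" and cover: "\<Omega> \<subseteq> \<Union>\<T>"
    using mesh closure_subset by (auto simp: mesh_def triangulation_def)
  define R where "R = (\<lambda>(u :: vector_field) (c :: (real^2) set \<times> nat \<times> nat \<times> nat \<Rightarrow> real).
    \<forall>K\<in>\<T>. AE x in lebesgue_on \<Omega>. x \<in> K \<longrightarrow> u x = rt_field k (\<lambda>i j l. c (K, i, j, l)) x)"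
  show thesis
  proof
    show "finite (\<T> \<times> {..k} \<times> {..k} \<times> {..2::nat})" using fin by simp
    show "function_subspace Vh" unfolding P(1) by (rule function_subspace_fe_space[OF \<Omega> P(2)])
    show "Vh \<subseteq> Hdiv0 \<Omega>" unfolding P(1) by (auto simp: fe_space_def)
    show "R (\<lambda>x. a *\<^sub>R u x + b *\<^sub>R v x) (\<lambda>j. a * c j + b * d j)" if "R u c" "R v d" for u v c d a b
      unfolding R_def
    proof
      fix K assume K: "K \<in> \<T>"
      with that have "AE x in lebesgue_on \<Omega>. x \<in> K \<longrightarrow> u x = rt_field k (\<lambda>i j l. c (K, i, j, l)) x"
        "AE x in lebesgue_on \<Omega>. x \<in> K \<longrightarrow> v x = rt_field k (\<lambda>i j l. d (K, i, j, l)) x"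
        by (auto simp: R_def)
      then show "AE x in lebesgue_on \<Omega>. x \<in> K \<longrightarrow> a *\<^sub>R u x + b *\<^sub>R v x
          = rt_field k (\<lambda>i j l. a * c (K, i, j, l) + b * d (K, i, j, l)) x"
        by eventually_elim (simp add: rt_field_lincomb)
    qed
    show "\<exists>c. R u c" if "u \<in> Vh" for u
    proof -
      have "\<forall>K\<in>\<T>. \<exists>c. AE x in lebesgue_on \<Omega>. x \<in> K \<longrightarrow> u x = rt_field k c x"
      proof
        fix K assume "K \<in> \<T>"
        with that obtain p where p: "p \<in> P K" "AE x in lebesgue_on \<Omega>. x \<in> K \<longrightarrow> u x = p x"
          unfolding P(1) fe_space_def by blast
        with P(3)[of K] RT_local_rt_field[of p k] show "\<exists>c. AE x in lebesgue_on \<Omega>. x \<in> K \<longrightarrow> u x = rt_field k c x"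
          by blast
      qed
      from bchoice[OF this] obtain c where
        "\<forall>K\<in>\<T>. AE x in lebesgue_on \<Omega>. x \<in> K \<longrightarrow> u x = rt_field k (c K) x" by blast
      then have "R u (\<lambda>(K, i, j, l). c K i j l)" by (simp add: R_def)
      then show ?thesis by blast
    qed
    show "AE x in lebesgue_on \<Omega>. u x = 0"
      if R: "R u c" and c: "\<forall>j\<in>\<T> \<times> {..k} \<times> {..k} \<times> {..2}. c j = 0" for u c
    proof -
      have "AE x in lebesgue_on \<Omega>. \<forall>K\<in>\<T>. x \<in> K \<longrightarrow> u x = 0"
      proof (rule AE_finite_allI[OF fin])
        fix K assume K: "K \<in> \<T>"
        have "rt_field k (\<lambda>i j l. c (K, i, j, l)) x = 0" for x
          unfolding rt_field_def using c K by (intro sum.neutral ballI) auto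
        moreover have "AE x in lebesgue_on \<Omega>. x \<in> K \<longrightarrow> u x = rt_field k (\<lambda>i j l. c (K, i, j, l)) x"
          using R K by (simp add: R_def)
        ultimately show "AE x in lebesgue_on \<Omega>. x \<in> K \<longrightarrow> u x = 0" by simp
      qed
      moreover have "AE x in lebesgue_on \<Omega>. x \<in> \<Omega>"
        using \<Omega> by (intro AE_I2) simp
      ultimately show ?thesis by eventually_elim (use cover in blast)
    qed
  qed
qed

section \<open>Energy decay for the semidiscrete problem\<close>

lemma norm_perp: "norm (perp v) = norm v"
  by (simp add: perp_def norm_eq_sqrt_inner inner_vec_def sum_2 add.commute)

lemma perp_inner_self: "perp v \<bullet> v = 0"
  by (simp add: perp_def inner_vec_def sum_2)

text \<open>A nonempty open set is not a null set, so the bounds are compared at some point.\<close>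

lemma AE_bounds_ordered:
  assumes \<Omega>: "bounded_domain \<Omega>" and C: "AE x in lebesgue_on \<Omega>. (a::real) \<le> g x \<and> g x \<le> b"
  shows "a \<le> b"
proof (rule ccontr)
  assume "\<not> a \<le> b"
  then have "AE x in lebesgue_on \<Omega>. False" by (intro eventually_mono[OF C]) auto
  then have "AE x in lebesgue. x \<notin> \<Omega>"
    using \<Omega> by (subst (asm) AE_restrict_space_iff) (auto simp: bounded_domain_def)
  then have "negligible \<Omega>"
    using AE_iff_null_sets[of \<Omega> lebesgue] \<Omega>
    by (simp add: negligible_iff_null_sets bounded_domain_def)
  with \<Omega> open_not_negligible show False by (auto simp: bounded_domain_def)
qed

theorem theorem4p6:
  fixes \<Omega> :: "(real^2) set"
    and Vh :: "(real^2 \<Rightarrow> real^2) set"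
    and H f C :: "real^2 \<Rightarrow> real"
    and u ut utt :: "real \<Rightarrow> real^2 \<Rightarrow> real^2"
    and \<epsilon> \<beta> H_lo H_up C_lo C_up C_P \<alpha> \<alpha>1 \<alpha>2 chi t :: real
  assumes "bounded_domain \<Omega>"
    and "\<epsilon> > 0" and "\<beta> > 0"
    and "H \<in> borel_measurable (lebesgue_on \<Omega>)"
    and "0 < H_lo" and "AE x in lebesgue_on \<Omega>. H_lo \<le> H x \<and> H x \<le> H_up"
    and "f \<in> borel_measurable (lebesgue_on \<Omega>)"
    and "AE x in lebesgue_on \<Omega>. \<bar>f x\<bar> \<le> 1"
    and "C \<in> borel_measurable (lebesgue_on \<Omega>)"
    and "0 < C_lo" and "AE x in lebesgue_on \<Omega>. C_lo \<le> C x \<and> C x \<le> C_up"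
    and "mixed_fe_space \<Omega> Vh"
    and "C_P > 0"
    and "friedrichs_constant \<Omega> H (Hdiv0 \<Omega>) C_P"
    and "friedrichs_constant \<Omega> H Vh C_P"
    and "damped_semidiscrete_solution \<Omega> Vh H f C \<epsilon> \<beta> u ut utt"
    and "\<alpha>1 = sqrt (\<beta> * H_lo) / (2 * C_P * \<epsilon>)"
    and "chi = 2 + C_P\<^sup>2 * (1 + \<epsilon> * C_up)\<^sup>2 / (\<beta> * H_lo)"
    and "\<alpha>2 = 2 * C_lo / (1 + chi)"
    and "0 < \<alpha>" and "\<alpha> \<le> min \<alpha>1 \<alpha>2"
    and "t > 0"
  shows "energy \<Omega> H \<epsilon> \<beta> u ut t \<le> 3 * energy \<Omega> H \<epsilon> \<beta> u ut 0 * exp (- (2 * \<alpha> / 3) * t)"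
proof -
  note \<Omega> = \<open>bounded_domain \<Omega>\<close>
  note pos = \<open>\<epsilon> > 0\<close> \<open>\<beta> > 0\<close> \<open>0 < H_lo\<close> \<open>0 < C_lo\<close> \<open>C_P > 0\<close> \<open>0 < \<alpha>\<close>
  note H_ae = \<open>AE x in lebesgue_on \<Omega>. H_lo \<le> H x \<and> H x \<le> H_up\<close>
  note C_ae = \<open>AE x in lebesgue_on \<Omega>. C_lo \<le> C x \<and> C x \<le> C_up\<close>
  note f_ae = \<open>AE x in lebesgue_on \<Omega>. \<bar>f x\<bar> \<le> 1\<close>
  have C_up: "C_up > 0" using AE_bounds_ordered[OF \<Omega> C_ae] pos by simp
  let ?w = "\<lambda>x. 1 / H x"
  \<comment> \<open>The kinetic form, the potential form, and the lower order terms of the equation.\<close>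
  define B where "B = (\<lambda>u v :: vector_field. l2_inner \<Omega> (\<lambda>x. ?w x *\<^sub>R u x) v)"
  define D where "D = (\<lambda>u v. l2_inner \<Omega> (wdiv \<Omega> u) (wdiv \<Omega> v))"
  define K where "K = (\<lambda>u v. 1 / \<epsilon> * l2_inner \<Omega> (\<lambda>x. (f x / H x) *\<^sub>R perp (u x)) v
    + l2_inner \<Omega> (\<lambda>x. (C x / H x) *\<^sub>R u x) v)"
  have w: "?w \<in> borel_measurable (lebesgue_on \<Omega>)" "AE x in lebesgue_on \<Omega>. 0 \<le> ?w x \<and> ?w x \<le> 1 / H_lo"
  proof -
    show "?w \<in> borel_measurable (lebesgue_on \<Omega>)" using assms(4) by measurable
    show "AE x in lebesgue_on \<Omega>. 0 \<le> ?w x \<and> ?w x \<le> 1 / H_lo"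
      using H_ae by eventually_elim (use pos in \<open>auto simp: frac_le\<close>)
  qed
  obtain J and R :: "vector_field \<Rightarrow> ((real^2) set \<times> nat \<times> nat \<times> nat \<Rightarrow> real) \<Rightarrow> bool" where J: "finite J" and Vh: "function_subspace Vh" "Vh \<subseteq> Hdiv0 \<Omega>"
    and R: "\<And>u v c d a b. R u c \<Longrightarrow> R v d \<Longrightarrow> R (\<lambda>x. a *\<^sub>R u x + b *\<^sub>R v x) (\<lambda>j. a * c j + b * d j)"
      "\<And>u. u \<in> Vh \<Longrightarrow> \<exists>c. R u c"
      "\<And>u c. u \<in> Vh \<Longrightarrow> R u c \<Longrightarrow> (\<forall>j\<in>J. c j = (0::real)) \<Longrightarrow> (AE x in lebesgue_on \<Omega>. u x = 0)"
    by (rule mixed_fe_space_coefficients[OF \<Omega> \<open>mixed_fe_space \<Omega> Vh\<close>], (rule that; assumption))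
  have Vh_Hdiv: "Vh \<subseteq> Hdiv \<Omega>" using Vh(2) by (auto simp: Hdiv0_def)
  then have Vh_L2: "Vh \<subseteq> L2 \<Omega>" using Hdiv_L2(1) by blast
  interpret BL: semi_inner_space "L2 \<Omega> :: vector_field set" B
    unfolding B_def by (rule semi_inner_space_weighted[OF w])
  interpret DL: semi_inner_space "Hdiv \<Omega>" D
    unfolding D_def by (rule semi_inner_space_wdiv[OF \<Omega>])
  have B: "semi_inner_space Vh B"
    by (rule semi_inner_space_subset[OF BL.semi_inner_space_axioms Vh(1) Vh_L2])
  have D: "semi_inner_space Vh D"
    by (rule semi_inner_space_subset[OF DL.semi_inner_space_axioms Vh(1) Vh_Hdiv])
  interpret B: semi_inner_space Vh B by (rule B)
  interpret D: semi_inner_space Vh D by (rule D)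
  have B_norm: "B.N v = sqrt (l2_inner \<Omega> (\<lambda>x. ?w x *\<^sub>R v x) v)" for v
    by (subst B.N_def) (simp add: B_def)
  have D_norm: "D.N v = sqrt (l2_inner \<Omega> (wdiv \<Omega> v) (wdiv \<Omega> v))" for v
    by (subst D.N_def) (simp add: D_def)
  define Z where "Z = {z \<in> Vh. div_free \<Omega> z}"
  have Z: "function_subspace Z"
    unfolding Z_def by (rule function_subspace_div_free[OF \<Omega> Vh(1) Vh_Hdiv])
  have Z_Vh: "Z \<subseteq> Vh" by (auto simp: Z_def)
  have D_Z: "D z z = 0" if "z \<in> Z" for z
  proof -
    have "AE x in lebesgue_on \<Omega>. wdiv \<Omega> z x \<bullet> wdiv \<Omega> z x = 0"
      using that unfolding Z_def div_free_def by auto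
    then show ?thesis unfolding D_def l2_inner_def by (rule integral_eq_zero_AE)
  qed
  have proj: "\<exists>p\<in>Z. \<forall>z\<in>Z. B (\<lambda>x. v x - p x) z = 0" if "v \<in> Vh" for v
  proof (rule B.ex_orthogonal_projection[OF J Z Z_Vh, of R])
    show "\<exists>c. R z c" if "z \<in> Z" for z using R(2) that Z_Vh by blast
    show "B z z = 0" if z: "z \<in> Z" and c: "R z c" "\<forall>j\<in>J. c j = 0" for z c
    proof -
      have "AE x in lebesgue_on \<Omega>. z x = 0" using R(3)[OF _ c] z Z_Vh by blast
      then have "AE x in lebesgue_on \<Omega>. (?w x *\<^sub>R z x) \<bullet> z x = 0" by eventually_elim simp
      then show ?thesis unfolding B_def l2_inner_def by (rule integral_eq_zero_AE)
    qed
  qed (use R(1) that in auto)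
  \<comment> \<open>The factor \<open>1 / sqrt H_lo\<close> passes from the weighted to the plain norm of the divergence.\<close>
  define M where "M = C_P / sqrt H_lo"
  have friedrichs: "B.N (\<lambda>x. v x - p x) \<le> M * sqrt (D v v)"
    if v: "v \<in> Vh" and p: "p \<in> Z" and orth: "\<forall>z\<in>Z. B (\<lambda>x. v x - p x) z = 0" for v p
  proof -
    let ?d = "\<lambda>x. v x - p x"
    have mem: "p \<in> Vh" "?d \<in> Vh" using v p Z_Vh B.in_X(2) by auto
    have "helmholtz_decomp \<Omega> H Vh v ?d p"
      using v p mem orth by (simp add: helmholtz_decomp_def Z_def B_def)
    with assms(15) have fr: "weighted_norm \<Omega> ?w ?d \<le> C_P * weighted_norm \<Omega> ?w (wdiv \<Omega> ?d)"
      unfolding friedrichs_constant_def by blast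
    \<comment> \<open>The two fields have the same divergence, since \<open>p\<close> is divergence-free.\<close>
    have Ddd: "D ?d ?d = D v v"
    proof -
      have "D v p = 0" "D p v = 0"
        using D.B_null[OF v mem(1) D_Z[OF p]] D.sym[OF v mem(1)] by auto
      then show ?thesis
        using D_Z[OF p] by (simp add: D.diff[OF v mem(1) mem(2)] D.diff_right[OF v mem(1)] v mem(1))
    qed
    have "wdiv \<Omega> ?d \<in> L2 \<Omega>" using mem Vh_Hdiv Hdiv_L2(2) by blast
    then have "l2_inner \<Omega> (\<lambda>x. ?w x *\<^sub>R wdiv \<Omega> ?d x) (wdiv \<Omega> ?d)
        \<le> l2_inner \<Omega> (\<lambda>x. (1 / H_lo) *\<^sub>R wdiv \<Omega> ?d x) (wdiv \<Omega> ?d)"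
      by (rule l2_inner_self_mono[where c = "1 / H_lo"]) (use w pos in auto)
    also have "\<dots> = D v v / H_lo" using Ddd by (simp add: D_def l2_inner_def)
    finally have "weighted_norm \<Omega> ?w (wdiv \<Omega> ?d) \<le> sqrt (D v v / H_lo)"
      unfolding weighted_norm_eq by (rule real_sqrt_le_mono)
    with fr pos have "weighted_norm \<Omega> ?w ?d \<le> C_P * sqrt (D v v / H_lo)"
      by (meson less_imp_le mult_left_mono order_trans)
    then show ?thesis
      by (simp add: B_norm weighted_norm_eq M_def real_sqrt_divide)
  qed
  have K_coercive: "C_lo * B v v \<le> K v v" if v: "v \<in> Vh" for v
  proof -
    have vL: "v \<in> L2 \<Omega>" using v Vh_L2 by blast
    \<comment> \<open>The rotation does no work.\<close>
    have "l2_inner \<Omega> (\<lambda>x. (f x / H x) *\<^sub>R perp (v x)) v = 0"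
      by (simp add: l2_inner_def perp_inner_self)
    moreover have "l2_inner \<Omega> (\<lambda>x. (C_lo / H x) *\<^sub>R v x) v \<le> l2_inner \<Omega> (\<lambda>x. (C x / H x) *\<^sub>R v x) v"
    proof (rule l2_inner_self_mono[OF vL, where c = "C_up / H_lo"])
      show "(\<lambda>x. C x / H x) \<in> borel_measurable (lebesgue_on \<Omega>)" using assms(4,9) by measurable
      show "AE x in lebesgue_on \<Omega>. \<bar>C x / H x\<bar> \<le> C_up / H_lo"
        using C_ae H_ae by eventually_elim (use pos in \<open>auto intro!: frac_le\<close>)
      show "AE x in lebesgue_on \<Omega>. 0 \<le> C_lo / H x \<and> C_lo / H x \<le> C x / H x"
        using C_ae H_ae by eventually_elim (use pos in \<open>auto intro!: divide_right_mono\<close>)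
    qed
    moreover have "l2_inner \<Omega> (\<lambda>x. (C_lo / H x) *\<^sub>R v x) v = C_lo * B v v"
      by (simp add: B_def l2_inner_def divide_inverse mult.assoc)
    ultimately show ?thesis by (simp add: K_def)
  qed
  define k where "k = 1 / \<epsilon> + C_up"
  have K_bounded: "\<bar>K y v\<bar> \<le> k * (B.N y * B.N v)" if y: "y \<in> Vh" and v: "v \<in> Vh" for y v
  proof -
    have yL: "y \<in> L2 \<Omega>" and vL: "v \<in> L2 \<Omega>" using y v Vh_L2 by auto
    have "AE x in lebesgue_on \<Omega>. norm ((f x / H x) *\<^sub>R perp (y x)) \<le> 1 * (?w x * norm (y x))"
      using f_ae H_ae
      by eventually_elim (use pos in \<open>auto simp: norm_perp intro!: mult_left_le_one_le divide_right_mono\<close>)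
    from weighted_form_bound[OF w yL vL this]
    have 1: "\<bar>l2_inner \<Omega> (\<lambda>x. (f x / H x) *\<^sub>R perp (y x)) v\<bar> \<le> B.N y * B.N v"
      by (simp add: B_norm)
    have "AE x in lebesgue_on \<Omega>. norm ((C x / H x) *\<^sub>R y x) \<le> C_up * (?w x * norm (y x))"
      using C_ae H_ae
      by eventually_elim (use pos in \<open>auto intro!: mult_right_mono divide_right_mono\<close>)
    from weighted_form_bound[OF w yL vL this]
    have 2: "\<bar>l2_inner \<Omega> (\<lambda>x. (C x / H x) *\<^sub>R y x) v\<bar> \<le> C_up * (B.N y * B.N v)"
      using C_up by (simp add: B_norm)
    have "\<bar>K y v\<bar> \<le> 1 / \<epsilon> * \<bar>l2_inner \<Omega> (\<lambda>x. (f x / H x) *\<^sub>R perp (y x)) v\<bar>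
        + \<bar>l2_inner \<Omega> (\<lambda>x. (C x / H x) *\<^sub>R y x) v\<bar>"
      unfolding K_def by (rule order_trans[OF abs_triangle_ineq]) (use pos in \<open>simp add: abs_mult\<close>)
    also have "\<dots> \<le> 1 / \<epsilon> * (B.N y * B.N v) + C_up * (B.N y * B.N v)"
      by (rule add_mono[OF mult_left_mono[OF 1] 2]) (use pos in simp)
    also have "\<dots> = k * (B.N y * B.N v)" by (simp add: k_def algebra_simps)
    finally show ?thesis .
  qed
  have sol: "time_derivative \<Omega> Vh u ut" "time_derivative \<Omega> Vh ut utt"
    and eqn: "\<And>s v. s \<ge> 0 \<Longrightarrow> v \<in> Vh \<Longrightarrow>
        l2_inner \<Omega> (\<lambda>x. (1 / H x) *\<^sub>R utt s x) v
        + 1 / \<epsilon> * l2_inner \<Omega> (\<lambda>x. (f x / H x) *\<^sub>R perp (ut s x)) v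
        + \<beta> / \<epsilon>\<^sup>2 * l2_inner \<Omega> (wdiv \<Omega> (u s)) (wdiv \<Omega> v)
        + l2_inner \<Omega> (\<lambda>x. (C x / H x) *\<^sub>R ut s x) v = 0"
    using assms(16) unfolding damped_semidiscrete_solution_def by blast+
  have mem: "u s \<in> Vh" "ut s \<in> Vh" "utt s \<in> Vh" if "s \<ge> 0" for s
    using sol that by (auto simp: time_derivative_def)
  have N_le: "B.N q \<le> 1 / sqrt H_lo * Hdiv_norm \<Omega> q" "D.N q \<le> Hdiv_norm \<Omega> q" if q: "q \<in> Vh" for q
  proof -
    have qL: "q \<in> L2 \<Omega>" using q Vh_L2 by blast
    have nn: "0 \<le> l2_inner \<Omega> q q" by (simp add: l2_inner_def)
    have nn': "0 \<le> l2_inner \<Omega> (wdiv \<Omega> q) (wdiv \<Omega> q)" by (simp add: l2_inner_def)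
    have Hn: "Hdiv_norm \<Omega> q = sqrt (l2_inner \<Omega> q q + l2_inner \<Omega> (wdiv \<Omega> q) (wdiv \<Omega> q))"
      using nn nn' by (simp add: Hdiv_norm_def l2_norm_def)
    have "B q q \<le> l2_inner \<Omega> (\<lambda>x. (1 / H_lo) *\<^sub>R q x) q"
      unfolding B_def by (rule l2_inner_self_mono[OF qL, where c = "1 / H_lo"]) (use w pos in auto)
    also have "\<dots> = 1 / H_lo * l2_inner \<Omega> q q" by (simp add: l2_inner_def)
    finally have "B.N q \<le> sqrt (1 / H_lo * l2_inner \<Omega> q q)"
      unfolding B.N_def by (rule real_sqrt_le_mono)
    also have "\<dots> = 1 / sqrt H_lo * sqrt (l2_inner \<Omega> q q)" by (simp add: real_sqrt_mult real_sqrt_divide)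
    also have "\<dots> \<le> 1 / sqrt H_lo * Hdiv_norm \<Omega> q"
      using nn' pos by (intro mult_left_mono) (auto simp: Hn)
    finally show "B.N q \<le> 1 / sqrt H_lo * Hdiv_norm \<Omega> q" .
    show "D.N q \<le> Hdiv_norm \<Omega> q" using nn by (simp add: Hn D_norm)
  qed
  have deriv: "B.curve_derivative {0..} y s (y' s)" "D.curve_derivative {0..} y s (y' s)"
    if td: "time_derivative \<Omega> Vh y y'" and s: "s \<ge> 0" for y y' s
  proof -
    let ?q = "\<lambda>r x. (y r x - y s x) /\<^sub>R (r - s) - y' s x"
    have lim: "((\<lambda>r. Hdiv_norm \<Omega> (?q r)) \<longlongrightarrow> 0) (at s within {0..})"
      using td s by (simp add: time_derivative_def)
    have ev: "\<forall>\<^sub>F r in at s within {0..}. ?q r \<in> Vh"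
      unfolding eventually_at_filter
      by (intro always_eventually allI impI B.in_X(2,3)) (use td s in \<open>auto simp: time_derivative_def\<close>)
    show "B.curve_derivative {0..} y s (y' s)"
      unfolding B.curve_derivative_def
    proof (rule Lim_null_comparison)
      show "\<forall>\<^sub>F r in at s within {0..}. norm (B.N (?q r)) \<le> 1 / sqrt H_lo * Hdiv_norm \<Omega> (?q r)"
        using ev by eventually_elim (use N_le(1) B.N_nonneg in simp)
      show "((\<lambda>r. 1 / sqrt H_lo * Hdiv_norm \<Omega> (?q r)) \<longlongrightarrow> 0) (at s within {0..})"
        by (rule tendsto_mult_right_zero[OF lim])
    qed
    show "D.curve_derivative {0..} y s (y' s)"
      unfolding D.curve_derivative_def
    proof (rule Lim_null_comparison[OF _ lim])
      show "\<forall>\<^sub>F r in at s within {0..}. norm (D.N (?q r)) \<le> Hdiv_norm \<Omega> (?q r)"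
        using ev by eventually_elim (use N_le(2) D.N_nonneg in simp)
    qed
  qed
  show ?thesis
  proof (rule B.damped_wave_energy_decay[OF D Z Z_Vh D_Z proj friedrichs K_coercive K_bounded mem
        deriv(1)[OF sol(1)] deriv(1)[OF sol(2)] deriv(2)[OF sol(1)], where \<gamma> = "\<beta> / \<epsilon>\<^sup>2" and chi = chi])
    show "B (utt s) v + K (ut s) v + \<beta> / \<epsilon>\<^sup>2 * D (u s) v = 0" if "s \<ge> 0" "v \<in> Vh" for s v
      using eqn[OF that] by (simp add: B_def K_def D_def)
    show "0 < \<beta> / \<epsilon>\<^sup>2" "0 < M" "0 \<le> k" "0 < \<alpha>" "0 \<le> t"
      using pos C_up \<open>t > 0\<close> by (auto simp: M_def k_def)
    show "chi = 2 + M\<^sup>2 * k\<^sup>2 / (\<beta> / \<epsilon>\<^sup>2)"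
    proof -
      have "1 + \<epsilon> * C_up = \<epsilon> * k" using pos by (simp add: k_def field_simps)
      with assms(18) pos show ?thesis by (simp add: M_def power_mult_distrib power_divide mult_ac)
    qed
    show "\<alpha> \<le> sqrt (\<beta> / \<epsilon>\<^sup>2) / (2 * M)"
      using assms(17,21) pos by (simp add: M_def real_sqrt_divide real_sqrt_mult mult_ac)
    show "\<alpha> \<le> 2 * C_lo / (1 + chi)" using assms(19,21) by simp
    show "energy \<Omega> H \<epsilon> \<beta> u ut s = 1 / 2 * B (ut s) (ut s) + \<beta> / \<epsilon>\<^sup>2 / 2 * D (u s) (u s)" for s
    proof -
      have "AE x in lebesgue_on \<Omega>. 0 \<le> (?w x *\<^sub>R ut s x) \<bullet> ut s x"
        using w(2) by eventually_elim simp
      then have "0 \<le> B (ut s) (ut s)" unfolding B_def l2_inner_def by (rule integral_nonneg_AE)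
      moreover have "0 \<le> D (u s) (u s)" by (simp add: D_def l2_inner_def)
      ultimately show ?thesis
        by (simp add: energy_def weighted_norm_eq l2_norm_def B_def D_def mult.commute)
    qed
  qed
qed

end
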